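(* Let $n$ be a degree and $\omega\in(0,(n+1)\pi)$. Let $r$ be an $(n,n)$-rational function together with nodes $x_1<\dots<x_{2n+1}$ in $(-1,1)$ and points $\eta_1,\dots,\eta_{2n+2}$ with $-1\le \eta_1<x_1<\eta_2<x_2<\dots<x_{2n+1}<\eta_{2n+2}\le 1$ such that (a) $r(\mathrm{i}x_j)=\mathrm{e}^{\mathrm{i}\omega x_j}$ for $j=1,\dots,2n+1$; (b) with $\varepsilon_j:=|r(\mathrm{i}\eta_j)-\mathrm{e}^{\mathrm{i}\omega\eta_j}|$, one has $\max_{x\in[-1,x_1)}|r(\mathrm{i}x)-\mathrm{e}^{\mathrm{i}\omega x}|=\varepsilon_1$, $\max_{x\in(x_{j-1},x_j)}|r(\mathrm{i}x)-\mathrm{e}^{\mathrm{i}\omega x}|=\varepsilon_j$ for $j=2,\dots,2n+1$, and $\max_{x\in(x_{2n+1},1]}|r(\mathrm{i}x)-\mathrm{e}^{\mathrm{i}\omega x}|=\varepsilon_{2n+2}$; (c) $\|r-\exp(\omega\cdot)\|<2$; (d) the phase function $g$ of $r$ satisfies, for some $\iota\in\{0,1\}$, $g(\eta_j)-\omega\eta_j=(-1)^{j+\iota}|g(\eta_j)-\omega\eta_j|$ for $j=1,\dots,2n+2$. Define the error in uniformity $$\delta=1-\frac{\min_{j=1,\dots,2n+2}\varepsilon_j}{\max_{k=1,\dots,2n+2}\varepsilon_k}.$$ Then the unitary best approximant $\widetilde r$ satisfies $$(1-\delta)\,\|r-\exp(\omega\cdot)\|\le\|\widetilde r-\exp(\omega\cdot)\|\le\|r-\exp(\omega\cdot)\|,$$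 and in particular $$\frac{\big|\,\|r-\exp(\omega\cdot)\|-\|\widetilde r-\exp(\omega\cdot)\|\,\big|}{\|r-\exp(\omega\cdot)\|}\le\delta.$$ Moreover, let $\{r_j\}_{j\in\mathbb N}$ be a sequence of $(n,n)$-rational functions (with the same $n$ and $\omega$) such that each $r_j$, with its own nodes and points, satisfies conditions (a)--(d), and let $\delta_j$ denote the error in uniformity of $r_j$. If $\delta_j\to0$ as $j\to\infty$, then $\|r_j-\widetilde r\|\to0$ as $j\to\infty$.
   Context: The degree $n$ is a non-negative integer and $\omega$ is a real number (the frequency). An $(n,n)$-rational function is a function $p/q$ with $p,q$ complex polynomials of degree $\le n$, $q\ne0$ (common factors being cancelled). A rational function $r$ is unitary if $|r(\mathrm{i}x)|=1$ for all $x\in\mathbb R$; $\mathcal U_n$ is the set of unitary $(n,n)$-rational functions. For a complex function $f$, $\|f\|:=\max_{x\in[-1,1]}|f(\mathrm{i}x)|$; thus $\|r-\exp(\omega\cdot)\|=\max_{x\in[-1,1]}|r(\mathrm{i}x)-\mathrm{e}^{\mathrm{i}\omega x}|$. For $\omega\in(0,(n+1)\pi)$ it is known that there is a unique $\widetilde r\in\mathcal U_n$, called the unitary best approximant, with $\|\widetilde r-\exp(\omega\cdot)\|=\min_{r\in\mathcal U_n}\|r-\exp(\omega\cdot)\|$. It is known that an $(n,n)$-rational function $r$ satisfying $r(\mathrm{i}x_j)=\mathrm{e}^{\mathrm{i}\omega x_j}$ at $2n+1$ distinct real nodes $x_j$ is unitary. For $r\in\mathcal U_n$ with $\|r-\exp(\omega\cdot)\|<2$,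 the phase function of $r$ is the function $g$ with $r(\mathrm{i}x)=\mathrm{e}^{\mathrm{i}g(x)}$ and $\max_{x\in[-1,1]}|g(x)-\omega x|<\pi$ (it exists, and its values on $[-1,1]$ are uniquely determined by these conditions: $g(x)-\omega x\in(-\pi,\pi)$ is the argument of $r(\mathrm{i}x)/\mathrm{e}^{\mathrm{i}\omega x}$). The function $g(x)-\omega x$ is the phase error of $r$. *)

theory Defs
  imports Complex_Main "HOL-Computational_Algebra.Polynomial"
begin

text \<open>
  Rational functions are rendered as functions on the complex plane. Since numerator and
  denominator are coprime, the value at a point is undefined in the mathematical sense exactly
  at the poles, where division by zero yields the value 0.
\<close>

definition rational_functions :: "nat \<Rightarrow> (complex \<Rightarrow> complex) set" where
  "rational_functions n =
     {r. \<exists>p q. degree p \<le> n \<and> degree q \<le> n \<and> q \<noteq> 0 \<and> coprime p q \<and>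
               r = (\<lambda>z. poly p z / poly q z)}"

text \<open>
  A unitary function has no pole on the imaginary axis: the value 0 assigned there would
  violate the modulus condition.
\<close>

definition unitary_functions :: "nat \<Rightarrow> (complex \<Rightarrow> complex) set" where
  "unitary_functions n =
     {r \<in> rational_functions n. \<forall>x::real. cmod (r (\<i> * of_real x)) = 1}"

text \<open>
  The supremum is the maximum whenever \<open>f\<close> is continuous on the segment from \<open>-\<i>\<close> to \<open>\<i>\<close>, e.g. if
  \<open>f\<close> is the difference of a unitary function and \<open>exp (\<omega> * z)\<close>, or of two unitary functions.
\<close>

definition imag_norm :: "(complex \<Rightarrow> complex) \<Rightarrow> real" where
  "imag_norm f = (SUP x\<in>{-1..1::real}. cmod (f (\<i> * of_real x)))"

definition approx_error :: "real \<Rightarrow> (complex \<Rightarrow> complex) \<Rightarrow> real" where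
  "approx_error \<omega> r = imag_norm (\<lambda>z. r z - exp (of_real \<omega> * z))"

definition pointwise_error :: "real \<Rightarrow> (complex \<Rightarrow> complex) \<Rightarrow> real \<Rightarrow> real" where
  "pointwise_error \<omega> r x = cmod (r (\<i> * of_real x) - cis (\<omega> * x))"

definition unitary_best_approximant :: "nat \<Rightarrow> real \<Rightarrow> (complex \<Rightarrow> complex) \<Rightarrow> bool" where
  "unitary_best_approximant n \<omega> r \<longleftrightarrow>
     is_arg_min (approx_error \<omega>) (\<lambda>s. s \<in> unitary_functions n) r"

text \<open>
  For unitary \<open>r\<close> with \<open>approx_error \<omega> r < 2\<close> such a \<open>g\<close> exists, and its values on \<open>[-1, 1]\<close> are
  uniquely determined (and continuous there, so the pointwise bound bounds the maximum by \<open>\<pi>\<close>).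
\<close>

definition phase_function :: "real \<Rightarrow> (complex \<Rightarrow> complex) \<Rightarrow> (real \<Rightarrow> real) \<Rightarrow> bool" where
  "phase_function \<omega> r g \<longleftrightarrow>
     (\<forall>x. r (\<i> * of_real x) = cis (g x)) \<and> (\<forall>x\<in>{-1..1}. \<bar>g x - \<omega> * x\<bar> < pi)"

text \<open>
  The nodes are \<open>x 1, \<dots>, x (2 * n + 1)\<close> and the points \<open>\<eta> 1, \<dots>, \<eta> (2 * n + 2)\<close>; values at other
  indices are irrelevant.
\<close>

definition interlaced :: "nat \<Rightarrow> (nat \<Rightarrow> real) \<Rightarrow> (nat \<Rightarrow> real) \<Rightarrow> bool" where
  "interlaced n x \<eta> \<longleftrightarrow>
     (\<forall>j\<in>{1..2*n+1}. x j \<in> {-1<..<1}) \<and> strict_mono_on {1..2*n+1} x \<and>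
     -1 \<le> \<eta> 1 \<and> (\<forall>j\<in>{1..2*n+1}. \<eta> j < x j \<and> x j < \<eta> (j+1)) \<and> \<eta> (2*n+2) \<le> 1"

text \<open>
  That the maximum of the error over a subinterval equals the error at \<open>\<eta> j\<close> is expressed by
  \<open>\<eta> j\<close> being a maximiser over that subinterval, which contains \<open>\<eta> j\<close> by interlacing.
\<close>

definition interpolatory_alternating ::
  "nat \<Rightarrow> real \<Rightarrow> (complex \<Rightarrow> complex) \<Rightarrow> (nat \<Rightarrow> real) \<Rightarrow> (nat \<Rightarrow> real) \<Rightarrow> bool" where
  "interpolatory_alternating n \<omega> r x \<eta> \<longleftrightarrow>
     r \<in> rational_functions n \<and>
     interlaced n x \<eta> \<and>
     (\<forall>j\<in>{1..2*n+1}. r (\<i> * of_real (x j)) = cis (\<omega> * x j)) \<and>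
     is_arg_max (pointwise_error \<omega> r) (\<lambda>t. t \<in> {-1..<x 1}) (\<eta> 1) \<and>
     (\<forall>j\<in>{2..2*n+1}.
        is_arg_max (pointwise_error \<omega> r) (\<lambda>t. t \<in> {x (j-1)<..<x j}) (\<eta> j)) \<and>
     is_arg_max (pointwise_error \<omega> r) (\<lambda>t. t \<in> {x (2*n+1)<..1}) (\<eta> (2*n+2)) \<and>
     approx_error \<omega> r < 2 \<and>
     (\<exists>g. phase_function \<omega> r g \<and>
        (\<exists>\<iota>\<in>{0, 1::nat}. \<forall>j\<in>{1..2*n+2}.
           g (\<eta> j) - \<omega> * \<eta> j = (-1) ^ (j + \<iota>) * \<bar>g (\<eta> j) - \<omega> * \<eta> j\<bar>))"

definition error_in_uniformity ::
  "nat \<Rightarrow> real \<Rightarrow> (complex \<Rightarrow> complex) \<Rightarrow> (nat \<Rightarrow> real) \<Rightarrow> real" where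
  "error_in_uniformity n \<omega> r \<eta> =
     1 - Min ((\<lambda>j. pointwise_error \<omega> r (\<eta> j)) ` {1..2*n+2}) /
         Max ((\<lambda>k. pointwise_error \<omega> r (\<eta> k)) ` {1..2*n+2})"

end

theory Submission
  imports Defs "HOL-Analysis.Analysis" "HOL-Computational_Algebra.Polynomial_Factorial"
    "HOL-Computational_Algebra.Field_as_Ring"
begin

text \<open>
  On the imaginary axis a unitary function is \<open>cnj P / P\<close> for a polynomial \<open>P\<close> of degree at most \<open>n\<close> in
  the real variable \<open>x\<close>, coprime to its conjugate. For two such functions, with denominators \<open>P\<close> and
  \<open>Q\<close>, the sign of the difference of the phases is that of the real polynomial \<open>Im (cnj P * Q)\<close>, up to
  a global sign. It has degree at most \<open>2 * n\<close>, hence vanishes if it alternates weakly at \<open>2 * n + 2\<close>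
  points. This gives the lower bound \<open>min \<epsilon>\<^sub>j\<close> on the error of every unitary function.

  A best approximant with error less than 2 and denominator \<open>Q\<close> of degree \<open>m\<close> has a phase error
  alternating between its extreme values at \<open>n + m + 2\<close> points, as otherwise moving \<open>Q\<close> in a suitable
  direction decreases the error. Interior extrema are zeros of a polynomial of degree \<open>2 * m\<close>, so
  \<open>m = n\<close>. If the errors of unitary functions converge to the minimum, then a limit \<open>L\<close> of their
  normalized denominators makes \<open>Im (cnj L * Q)\<close> alternate weakly at these \<open>2 * n + 2\<close> points, so it is
  zero and \<open>L\<close> is a constant multiple of \<open>Q\<close>. As \<open>Q\<close> has no zeros on \<open>[-1, 1]\<close>, convergence is uniform.
\<close>

section \<open>Polynomials\<close>

lemma poly_map_poly_Im: "poly (map_poly Im p) x = Im (poly p (complex_of_real x))"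
  by (induction p) (simp_all add: map_poly_pCons)

lemma degree_map_poly_Im_le: "degree (map_poly Im p) \<le> degree p"
  by (rule degree_le) (simp add: coeff_map_poly coeff_eq_0)

text \<open>Reduces polynomial identities involving \<open>map_poly cnj\<close> to pointwise ones on
  the real line, where conjugating the coefficients conjugates the value.\<close>

lemma poly_eqI_of_real:
  fixes p q :: "complex poly"
  assumes "\<And>x::real. poly p (of_real x) = poly q (of_real x)"
  shows "p = q"
proof (rule ccontr)
  assume "p \<noteq> q"
  then have "finite {z. poly (p - q) z = 0}"
    by (intro poly_roots_finite) simp
  moreover have "range complex_of_real \<subseteq> {z. poly (p - q) z = 0}"
    using assms by auto
  moreover have "infinite (range complex_of_real)"
    by (simp add: finite_image_iff inj_def infinite_UNIV_char_0)
  ultimately show False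
    using finite_subset by blast
qed

lemma degree_map_poly_cnj: "degree (map_poly cnj p) = degree p"
  by (rule degree_map_poly) simp

lemma coprime_poly_bezout:
  fixes p q :: "complex poly"
  assumes "coprime p q"
  obtains u v where "u * p + v * q = 1"
  using bezout_coefficients_fst_snd[of p q] assms by (metis coprime_imp_gcd_eq_1)

text \<open>Composition with \<open>l\<close> preserves a Bezout identity, and a common divisor of
  the compositions then divides 1.\<close>

lemma coprime_pcompose:
  fixes p q :: "complex poly"
  assumes "coprime p q"
  shows "coprime (pcompose p l) (pcompose q l)"
proof -
  obtain u v where uv: "u * p + v * q = 1"
    using coprime_poly_bezout[OF assms] .
  have "pcompose u l * pcompose p l + pcompose v l * pcompose q l = pcompose (u * p + v * q) l"
    by (simp add: pcompose_add pcompose_mult)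
  then have *: "pcompose u l * pcompose p l + pcompose v l * pcompose q l = 1"
    unfolding uv by (simp add: pcompose_1)
  show ?thesis
  proof (rule coprimeI)
    fix c assume "c dvd pcompose p l" "c dvd pcompose q l"
    then have "c dvd pcompose u l * pcompose p l + pcompose v l * pcompose q l" by simp
    then show "is_unit c" unfolding * .
  qed
qed

text \<open>
  Compare the coefficients of \<open>x ^ (k + 1)\<close> in \<open>D\<close> and in its Lagrange interpolant: this yields a
  vanishing linear combination of the values \<open>(-1) ^ j * poly D (\<xi> j)\<close> with coefficients of one sign.
\<close>

lemma alternating_sign_imp_zero:
  fixes D :: "real poly" and \<xi> :: "nat \<Rightarrow> real"
  assumes deg: "degree D \<le> k"
    and mono: "strict_mono_on {..Suc k} \<xi>"
    and alt: "\<And>j. j \<le> Suc k \<Longrightarrow> 0 \<le> (-1) ^ j * poly D (\<xi> j)"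
  shows "D = 0"
proof -
  define I where "I = {..Suc k}"
  define W where "W = (\<lambda>j. \<Prod>i\<in>I - {j}. \<xi> j - \<xi> i)"
  define N where "N = (\<lambda>j. \<Prod>i\<in>I - {j}. [:- \<xi> i, 1:])"
  define L where "L = (\<Sum>j\<in>I. smult (poly D (\<xi> j) / W j) (N j))"
  have lt: "\<xi> i < \<xi> j" if "i < j" "j \<in> I" for i j
    using mono that unfolding strict_mono_on_def I_def by auto
  have inj: "inj_on \<xi> I"
    using mono strict_mono_on_imp_inj_on unfolding I_def by blast
  have W0: "W j \<noteq> 0" if "j \<in> I" for j
    using that inj by (auto simp: W_def I_def inj_on_def)
  have polyN: "poly (N j) x = (\<Prod>i\<in>I - {j}. x - \<xi> i)" for j x
    by (simp add: N_def poly_prod)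
  have "lead_coeff (N j) = 1" "degree (N j) = card (I - {j})" for j
    unfolding N_def lead_coeff_prod by (simp_all add: degree_prod_eq_sum_degree)
  then have N: "degree (N j) = Suc k" "coeff (N j) (Suc k) = 1" if "j \<in> I" for j
    using that by (metis I_def card_Diff_singleton card_atMost diff_Suc_1)+
  have "L = D"
  proof (rule poly_eqI_degree[of "\<xi> ` I"])
    fix x assume "x \<in> \<xi> ` I"
    then obtain l where l: "l \<in> I" "x = \<xi> l" by auto
    have "poly (N j) (\<xi> l) = (if j = l then W l else 0)" if "j \<in> I" for j
      using l that by (auto simp: polyN W_def I_def)
    then have "poly L x = (\<Sum>j\<in>I. if j = l then poly D (\<xi> j) / W j * W l else 0)"
      unfolding L_def poly_sum poly_smult l by (intro sum.cong) auto
    also have "\<dots> = poly D x"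
      using l W0 by (simp add: I_def)
    finally show "poly L x = poly D x" .
  next
    have "card (\<xi> ` I) = Suc (Suc k)"
      using inj by (simp add: card_image I_def)
    moreover have "degree L \<le> Suc k"
      unfolding L_def by (intro degree_sum_le) (auto simp: I_def intro: order_trans[OF degree_smult_le] simp: N)
    ultimately show "degree L < card (\<xi> ` I)" "degree D < card (\<xi> ` I)"
      using deg by auto
  qed
  moreover have "coeff L (Suc k) = (\<Sum>j\<in>I. poly D (\<xi> j) / W j)"
    unfolding L_def coeff_sum coeff_smult by (intro sum.cong) (auto simp: N)
  ultimately have sum0: "(\<Sum>j\<in>I. poly D (\<xi> j) / W j) = 0"
    using deg by (simp add: coeff_eq_0)
  \<comment> \<open>Exactly the \<open>Suc k - j\<close> factors with \<open>i > j\<close> are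
    negative.\<close>
  have signW: "0 < (-1) ^ (Suc k - j) * W j" if "j \<in> I" for j
  proof -
    have "W j = (\<Prod>i\<in>{..<j}. \<xi> j - \<xi> i) * (\<Prod>i\<in>{j<..Suc k}. \<xi> j - \<xi> i)"
      unfolding W_def using that
      by (subst prod.union_disjoint[symmetric]) (auto simp: I_def intro!: prod.cong)
    also have "(\<Prod>i\<in>{j<..Suc k}. \<xi> j - \<xi> i) = (\<Prod>i\<in>{j<..Suc k}. (-1) * (\<xi> i - \<xi> j))"
      by (intro prod.cong) auto
    also have "\<dots> = (-1) ^ (Suc k - j) * (\<Prod>i\<in>{j<..Suc k}. \<xi> i - \<xi> j)"
      by (simp only: prod.distrib) simp
    finally have "(-1) ^ (Suc k - j) * W j =
        (\<Prod>i\<in>{..<j}. \<xi> j - \<xi> i) * (\<Prod>i\<in>{j<..Suc k}. \<xi> i - \<xi> j)"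
      by (cases "even (Suc k - j)") auto
    also have "0 < \<dots>"
      using that by (intro mult_pos_pos prod_pos) (auto intro!: lt simp: I_def)
    finally show ?thesis .
  qed
  have "0 \<le> (-1) ^ Suc k * (poly D (\<xi> j) / W j)" if "j \<in> I" for j
  proof -
    have e: "(-1) ^ Suc k = (-1::real) ^ (Suc k - j) * (-1) ^ j"
      using that by (simp add: I_def flip: power_add)
    have "(-1) ^ Suc k * (poly D (\<xi> j) / W j) =
        ((-1) ^ j * poly D (\<xi> j)) / ((-1) ^ (Suc k - j) * W j)"
      unfolding e by (cases "even (Suc k - j)") (auto simp: field_simps)
    then show ?thesis
      using signW[OF that] alt[of j] that by (simp add: I_def)
  qed
  moreover have "(\<Sum>j\<in>I. (-1) ^ Suc k * (poly D (\<xi> j) / W j)) = 0"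
    using sum0 by (simp only: flip: sum_distrib_left)
  \<comment> \<open>Nonnegative terms with sum 0 all vanish, so \<open>D\<close> is zero at every
    node and its interpolant is zero.\<close>
  ultimately have "\<forall>j\<in>I. (-1) ^ Suc k * (poly D (\<xi> j) / W j) = 0"
    using sum_nonneg_eq_0_iff[of I "\<lambda>j. (-1) ^ Suc k * (poly D (\<xi> j) / W j)"]
    by (simp add: I_def)
  then have "\<forall>j\<in>I. poly D (\<xi> j) = 0"
    using W0 by auto
  then have "L = 0"
    unfolding L_def by simp
  with \<open>L = D\<close> show ?thesis
    by simp
qed

text \<open>
  Solvability of the linearized problem: \<open>H\<close> is a direction in which to move \<open>Q\<close> so that the phase
  changes with the sign of \<open>w\<close>.
\<close>

lemma conj_factor_solvable:
  fixes Q :: "complex poly" and w :: "real poly"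
  assumes cop: "coprime Q (map_poly cnj Q)" and "Q \<noteq> 0" and "degree Q \<le> n"
    and degw: "degree w \<le> n + degree Q"
  obtains H where "degree H \<le> n"
    and "\<And>x::real. Im (cnj (poly Q (of_real x)) * poly H (of_real x)) = poly w x"
proof -
  define Q' where "Q' = map_poly cnj Q"
  define W where "W = map_poly complex_of_real w"
  obtain b a where ab: "b * Q + a * Q' = 1"
    using coprime_poly_bezout[OF cop] unfolding Q'_def .
  \<comment> \<open>Since \<open>a * Q'\<close> is 1 modulo \<open>Q\<close>, this \<open>h\<close>
    solves \<open>Q' * h = 2 * \<i> * W\<close> modulo \<open>Q\<close>; the reduction controls its
    degree.\<close>
  define h where "h = (smult (2 * \<i>) W * a) mod Q"
  have "h = 0 \<or> degree h < degree Q"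
    unfolding h_def using \<open>Q \<noteq> 0\<close> by (rule degree_mod_less)
  then have degh: "degree h \<le> n" "degree h \<le> degree Q"
    using \<open>degree Q \<le> n\<close> by auto
  have "smult (2 * \<i>) W * (b * Q + a * Q') = smult (2 * \<i>) W"
    unfolding ab by simp
  then have "Q' * h - smult (2 * \<i>) W =
      Q' * (h - smult (2 * \<i>) W * a) - Q * (smult (2 * \<i>) W * b)"
    by (simp only: algebra_simps)
  moreover have "Q dvd h - smult (2 * \<i>) W * a"
    unfolding h_def by (simp add: mod_eq_dvd_iff[symmetric])
  ultimately have "Q dvd Q' * h - smult (2 * \<i>) W"
    by (metis (no_types) dvd_diff[OF dvd_mult dvd_triv_left])
  then obtain k where k: "Q' * h - smult (2 * \<i>) W = Q * k" ..
  have "degree (Q' * h - smult (2 * \<i>) W) \<le> n + degree Q"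
  proof (rule degree_diff_le)
    have "degree (Q' * h) \<le> degree Q' + degree h" by (rule degree_mult_le)
    then show "degree (Q' * h) \<le> n + degree Q"
      using degh by (simp add: Q'_def degree_map_poly_cnj)
    have "degree W = degree w" unfolding W_def by (rule degree_map_poly) simp
    then show "degree (smult (2 * \<i>) W) \<le> n + degree Q"
      using degw by simp
  qed
  then have degk: "degree k \<le> n"
    unfolding k using \<open>Q \<noteq> 0\<close> by (cases "k = 0") (auto simp: degree_mult_eq)
  \<comment> \<open>On the real line \<open>cnj Q * h - Q * k = 2 * \<i> * w\<close>. As
    \<open>Im (Q * k) = - Im (cnj Q * cnj k)\<close>, the average of \<open>h\<close> and
    \<open>cnj k\<close> has the required imaginary part.\<close>
  define H where "H = smult (1/2) (h + map_poly cnj k)"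
  show thesis
  proof
    show "degree H \<le> n"
      unfolding H_def using degh degk by (auto intro!: degree_add_le simp: degree_map_poly_cnj)
  next
    fix x :: real
    have W: "poly W (of_real x) = of_real (poly w x)"
      unfolding W_def by (induction w) (simp_all add: map_poly_pCons)
    have "poly (Q' * h - smult (2 * \<i>) W) (of_real x) = poly (Q * k) (of_real x)"
      by (simp only: k)
    then have "cnj (poly Q (of_real x)) * poly h (of_real x) - 2 * \<i> * of_real (poly w x) =
        poly Q (of_real x) * poly k (of_real x)"
      by (simp add: Q'_def W)
    from arg_cong[OF this, of Im]
    show "Im (cnj (poly Q (of_real x)) * poly H (of_real x)) = poly w x"
      by (simp add: H_def field_simps)
  qed
qed

section \<open>Alternation or separation of extremal sets\<close>

text \<open>
  The last conjunct, on points to the left of \<open>B\<close>, is only there to make the induction work.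
\<close>

lemma alternation_or_separation_from:
  fixes A B :: "real set"
  assumes "compact A" "compact B" "A \<inter> B = {}" "a \<in> A" "\<forall>b\<in>B. a < b"
  shows "(\<exists>\<xi>. strict_mono_on {..N} \<xi> \<and> (\<forall>k\<le>N. \<xi> k \<in> (if even k then A else B))) \<or>
    (\<exists>w. degree w < N \<and> (\<forall>x\<in>A. 0 < poly w x) \<and> (\<forall>x\<in>B. poly w x < 0) \<and>
      (\<forall>x a. a \<in> A \<and> (\<forall>b\<in>B. a < b) \<and> x \<le> a \<longrightarrow> 0 < poly w x))"
  using assms
proof (induction N arbitrary: A B a)
  case 0
  then show ?case
    by (intro disjI1 exI[of _ "\<lambda>_. a"]) (auto simp: strict_mono_on_def)
next
  case (Suc N)
  show ?case
  proof (cases "B = {}")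
    case True
    then show ?thesis
      by (intro disjI2 exI[of _ 1]) auto
  next
    case False
    then obtain y where y: "y \<in> B" "\<And>b. b \<in> B \<Longrightarrow> y \<le> b"
      using compact_attains_inf[OF Suc.prems(2)] by blast
    have "compact (A \<inter> {..y})"
      using Suc.prems(1) by (intro compact_Int_closed) auto
    moreover have "a \<in> A \<inter> {..y}"
      using Suc.prems(4,5) y(1) by force
    ultimately obtain l where l: "l \<in> A \<inter> {..y}" "\<And>x. x \<in> A \<inter> {..y} \<Longrightarrow> x \<le> l"
      using compact_attains_sup[of "A \<inter> {..y}"] by blast
    have "l < y"
      using l(1) y(1) Suc.prems(3) by (metis IntE atMost_iff disjoint_iff order_le_less)
    \<comment> \<open>The new sign change is placed strictly between \<open>y\<close>, the first
      point of \<open>B\<close>, and \<open>l\<close>, the last point of \<open>A\<close> before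
      it.\<close>
    define c where "c = (l + y) / 2"
    have c: "l < c" "c < y"
      using \<open>l < y\<close> by (auto simp: c_def)
    define A' where "A' = A \<inter> {y..}"
    have A': "y < b" if "b \<in> A'" for b
      using that y(1) Suc.prems(3) by (metis A'_def IntE atLeast_iff disjoint_iff order_le_less)
    have "compact A'"
      unfolding A'_def using Suc.prems(1) by (intro compact_Int_closed) auto
    \<comment> \<open>The roles are swapped: \<open>B\<close> comes first, with leading point
      \<open>y\<close>. The last conjunct of the induction hypothesis makes \<open>w\<close>
      positive on all of \<open>{..y}\<close>, hence also at the points of \<open>A\<close> dropped
      from \<open>A'\<close>.\<close>
    then consider
        (alt) \<xi> where "strict_mono_on {..N} \<xi>" "\<And>k. k \<le> N \<Longrightarrow> \<xi> k \<in> (if even k then B else A')"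
      | (sep) w where "degree w < N" "\<And>x. x \<in> B \<Longrightarrow> 0 < poly w x"
          "\<And>x. x \<in> A' \<Longrightarrow> poly w x < 0" "\<And>x. x \<le> y \<Longrightarrow> 0 < poly w x"
      using Suc.IH[of B A' y] Suc.prems(2,3) y(1) A' unfolding A'_def by blast
    then show ?thesis
    proof cases
      case alt
      have "a < \<xi> k" if "k \<le> N" for k
        using alt(2)[OF that] A' Suc.prems(5) y(1) by (fastforce split: if_splits)
      then have "strict_mono_on {..Suc N} (case_nat a \<xi>)"
        using alt(1) by (auto simp: strict_mono_on_def split: nat.split)
      moreover have "case_nat a \<xi> k \<in> (if even k then A else B)" if "k \<le> Suc N" for k
        using that alt(2)[of "k - 1"] Suc.prems(4)
        by (cases k) (auto simp: A'_def split: if_splits)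
      ultimately show ?thesis
        by blast
    next
      case sep
      \<comment> \<open>The factor \<open>c - x\<close> reverses the signs of \<open>w\<close> on
        \<open>B\<close> and \<open>A'\<close>, which lie to the right of \<open>c\<close>, and
        keeps them on the points of \<open>A\<close> up to \<open>l\<close>.\<close>
      define v where "v = w * [:c, -1:]"
      have v: "poly v x = poly w x * (c - x)" for x
        by (simp add: v_def algebra_simps)
      have "degree v < Suc N"
        using degree_mult_le[of w "[:c, -1:]"] sep(1) by (auto simp: v_def)
      moreover have "0 < poly v x" if "x \<in> A" for x
      proof (cases "x \<le> y")
        case True
        then show ?thesis
          using l(2)[of x] that c sep(4)[of x] by (auto simp: v)
      next
        case False
        then show ?thesis
          using that c sep(3)[of x] by (auto simp: v A'_def mult_neg_neg)
      qed
      moreover have "poly v x < 0" if "x \<in> B" for x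
        using that c y(2)[of x] sep(2)[of x] by (auto simp: v mult_pos_neg)
      moreover have "0 < poly v x" if "d \<in> A" "\<forall>b\<in>B. d < b" "x \<le> d" for x d
      proof -
        have "d < y" using that y(1) by blast
        then have "d \<le> l" using that l(2)[of d] by auto
        then show ?thesis
          using that c sep(4)[of x] by (auto simp: v)
      qed
      ultimately show ?thesis
        by blast
    qed
  qed
qed

text \<open>Symmetric form of the preceding dichotomy: the set containing the leftmost point of the
  union takes the first role, and \<open>s\<close> records which one it is. It is applied to the
  points of extreme phase error of either sign.\<close>

lemma alternation_or_separation:
  fixes A B :: "real set"
  assumes AB: "compact A" "compact B" "A \<inter> B = {}" and "0 < N"
  obtains (alternation) \<xi> s where "strict_mono_on {..N} \<xi>" "s = 1 \<or> s = (-1::real)"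
      "\<And>k. k \<le> N \<Longrightarrow> \<xi> k \<in> (if s * (-1) ^ k = 1 then A else B)"
    | (separation) w where "degree w < N" "\<And>x. x \<in> A \<Longrightarrow> 0 < poly w x" "\<And>x. x \<in> B \<Longrightarrow> poly w x < 0"
proof -
  have even: "even k \<longleftrightarrow> (1::real) * (-1) ^ k = 1" "even k \<longleftrightarrow> \<not> (-1::real) * (-1) ^ k = 1" for k :: nat
    by (cases "even k"; simp)+
  consider "A = {}" "B = {}" | a where "a \<in> A" "\<forall>b\<in>B. a < b" | b where "b \<in> B" "\<forall>a\<in>A. b < a"
  proof (cases "A \<union> B = {}")
    case False
    then obtain m where m: "m \<in> A \<union> B" "\<And>x. x \<in> A \<union> B \<Longrightarrow> m \<le> x"
      using compact_attains_inf[OF compact_Un[OF AB(1,2)]] by blast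
    then show ?thesis
      using that AB(3) by (metis Un_iff disjoint_iff order_le_less)
  qed (use that in auto)
  then show thesis
  proof cases
    case 1
    then show ?thesis
      using separation[of 1] \<open>0 < N\<close> by auto
  next
    case (2 a)
    from alternation_or_separation_from[OF AB this, of N] show ?thesis
    proof (elim disjE exE conjE)
      fix \<xi> assume "strict_mono_on {..N} \<xi>" "\<forall>k\<le>N. \<xi> k \<in> (if even k then A else B)"
      then show thesis
        using alternation[of \<xi> 1] unfolding even(1) by blast
    qed (use separation in blast)
  next
    case (3 b)
    have "B \<inter> A = {}"
      using AB(3) by blast
    from alternation_or_separation_from[OF AB(2,1) this 3, of N] show ?thesis
    proof (elim disjE exE conjE)
      fix \<xi> assume "strict_mono_on {..N} \<xi>" "\<forall>k\<le>N. \<xi> k \<in> (if even k then B else A)"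
      then show thesis
        using alternation[of \<xi> "-1"] unfolding even(2) by (smt (verit))
    next
      fix w assume "degree w < N" "\<forall>x\<in>B. 0 < poly w x" "\<forall>x\<in>A. poly w x < 0"
      then show thesis
        using separation[of "- w"] by auto
    qed
  qed
qed

section \<open>Unitary functions as conjugate quotients\<close>

text \<open>Numerator \<open>a\<close> and denominator \<open>b\<close> have equal modulus on the
  real line, so \<open>a\<close> times its conjugate equals \<open>b\<close> times its conjugate. By
  coprimality, \<open>a\<close> divides the conjugate of \<open>b\<close>, and the cofactor is a
  unimodular constant \<open>u\<close>.\<close>

lemma unitary_imp_conj_quotient:
  assumes "r \<in> unitary_functions n"
  obtains P where "degree P \<le> n" "coprime P (map_poly cnj P)"
    "\<And>x::real. poly P (of_real x) \<noteq> 0"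
    "\<And>x::real. r (\<i> * of_real x) = cnj (poly P (of_real x)) / poly P (of_real x)"
proof -
  from assms obtain p q where pq: "degree p \<le> n" "degree q \<le> n" "coprime p q"
      "r = (\<lambda>z. poly p z / poly q z)"
    and uni: "\<And>x::real. cmod (r (\<i> * of_real x)) = 1"
    by (auto simp: unitary_functions_def rational_functions_def)
  \<comment> \<open>The substitution of \<open>\<i> * x\<close> for the variable moves the imaginary
    axis to the real line.\<close>
  define a where "a = pcompose p [:0, \<i>:]"
  define b where "b = pcompose q [:0, \<i>:]"
  have r: "r (\<i> * of_real x) = poly a (of_real x) / poly b (of_real x)" for x :: real
    by (simp add: a_def b_def pq poly_pcompose mult.commute)
  have "coprime a b"
    unfolding a_def b_def by (rule coprime_pcompose) fact
  have ne: "poly a (of_real x) \<noteq> 0" "poly b (of_real x) \<noteq> 0"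
    and norm_eq: "cmod (poly a (of_real x)) = cmod (poly b (of_real x))" for x :: real
    using uni[of x] by (auto simp: r norm_divide divide_eq_1_iff)
  have eq: "a * map_poly cnj a = b * map_poly cnj b"
    by (rule poly_eqI_of_real) (use norm_eq in \<open>simp add: complex_norm_square[symmetric]\<close>)
  have "a dvd b * map_poly cnj b"
    unfolding eq[symmetric] by simp
  then have "a dvd map_poly cnj b"
    using \<open>coprime a b\<close> coprime_dvd_mult_right_iff by blast
  then obtain e where e: "map_poly cnj b = a * e" ..
  have "map_poly cnj a = b * e"
  proof -
    have "a * map_poly cnj a = a * (b * e)"
      unfolding eq e by (simp add: mult_ac)
    moreover have "a \<noteq> 0" using ne(1)[of 0] by auto
    ultimately show ?thesis by simp
  qed
  moreover have "a \<noteq> 0" "b \<noteq> 0" "e \<noteq> 0"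
    using ne[of 0] arg_cong[OF e, of "\<lambda>p. poly p 0"] by auto
  \<comment> \<open>Each of \<open>a\<close>, \<open>b\<close> has the degree of the other plus that
    of \<open>e\<close>.\<close>
  ultimately have "degree a = degree b + degree e" "degree b = degree a + degree e"
    using e degree_map_poly_cnj[of a] degree_map_poly_cnj[of b] by (simp_all add: degree_mult_eq)
  then have "degree e = 0" by simp
  then obtain u where u: "e = [:u:]" by (rule degree_eq_zeroE)
  have bu: "cnj (poly b (of_real x)) = u * poly a (of_real x)" for x :: real
    using arg_cong[OF e, of "\<lambda>p. poly p (of_real x)"] by (simp add: u)
  have "cmod u * cmod (poly a 0) = cmod (poly b 0)"
    using arg_cong[OF bu[of 0], of cmod] by (simp add: norm_mult)
  then have "cmod u = 1"
    using norm_eq[of 0] ne[of 0] by simp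
  then obtain t where t: "u = cis t"
    by (metis cis_Arg div_by_1 norm_zero of_real_1 sgn_eq zero_neq_one)
  \<comment> \<open>Half the argument of \<open>u\<close>: conjugating \<open>P\<close> then gives
    \<open>cis (t/2) * a\<close>, and the common factor cancels in the quotient.\<close>
  define P where "P = smult (cis (t/2)) b"
  have cis2: "cis (t/2) * cis (t/2) = u" "cnj (cis (t/2)) = inverse (cis (t/2))"
    by (simp_all add: t cis_mult cis_inverse cis_cnj)
  show thesis
  proof
    show "degree P \<le> n"
      unfolding P_def b_def using pq(2) degree_pcompose[of q "[:0, \<i>:]"] by simp
    have "map_poly cnj P = smult (cnj (cis (t/2)) * u) a"
      by (rule poly_eqI_of_real) (simp add: P_def bu)
    moreover have "cnj (cis (t/2)) * u \<noteq> 0" "cis (t/2) \<noteq> 0"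
      using \<open>cmod u = 1\<close> by auto
    ultimately show "coprime P (map_poly cnj P)"
      using coprime_common_divisor[OF \<open>coprime a b\<close>]
      by (intro coprimeI) (simp add: P_def dvd_smult_iff)
    fix x :: real
    show "poly P (of_real x) \<noteq> 0"
      using ne by (simp add: P_def)
    show "r (\<i> * of_real x) = cnj (poly P (of_real x)) / poly P (of_real x)"
      using ne(2)[of x] bu[of x, folded cis2(1)] by (simp add: r P_def cis2(2) del: cis_cnj) (simp add: cis_mult)
  qed
qed

text \<open>A perturbed denominator may share factors with its conjugate and vanish outside
  \<open>[-1, 1]\<close>. Cancelling the greatest common divisor yields a reduced fraction, which
  agrees with the quotient wherever \<open>P\<close> is nonzero.\<close>

lemma conj_quotient_unitary:
  assumes "degree P \<le> n" "P \<noteq> 0"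
  obtains r where "r \<in> unitary_functions n"
    "\<And>x::real. poly P (of_real x) \<noteq> 0 \<Longrightarrow>
      r (\<i> * of_real x) = cnj (poly P (of_real x)) / poly P (of_real x)"
proof -
  define P' where "P' = map_poly cnj P"
  have "P' \<noteq> 0"
    using \<open>P \<noteq> 0\<close> by (metis P'_def degree_map_poly_cnj leading_coeff_0_iff coeff_map_poly complex_cnj_zero_iff complex_cnj_zero)
  then obtain a b where ab: "P' = a * gcd P' P" "P = b * gcd P' P" "coprime a b"
    using gcd_coprime_exists[of P' P] by auto
  define g where "g = gcd P' P"
  have ev: "cnj (poly P (of_real x)) = poly a (of_real x) * poly g (of_real x)"
      "poly P (of_real x) = poly b (of_real x) * poly g (of_real x)" for x :: real
    using arg_cong[OF ab(1), of "\<lambda>p. poly p (of_real x)"] arg_cong[OF ab(2), of "\<lambda>p. poly p (of_real x)"]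
    by (simp_all add: P'_def g_def)
  have "g \<noteq> 0"
    using ab(2) \<open>P \<noteq> 0\<close> by (auto simp: g_def)
  have "g * map_poly cnj g * (a * map_poly cnj a) = g * map_poly cnj g * (b * map_poly cnj b)"
  proof (rule poly_eqI_of_real)
    fix x :: real
    have "cnj (poly P (of_real x)) * cnj (cnj (poly P (of_real x))) = poly P (of_real x) * cnj (poly P (of_real x))"
      by simp
    then show "poly (g * map_poly cnj g * (a * map_poly cnj a)) (of_real x) =
        poly (g * map_poly cnj g * (b * map_poly cnj b)) (of_real x)"
      by (subst (asm) ev(1), subst (asm) ev(1), subst (asm) ev(2), subst (asm) ev(2)) (simp add: mult_ac)
  qed
  moreover have "map_poly cnj g \<noteq> 0"
    using \<open>g \<noteq> 0\<close> by (metis degree_map_poly_cnj leading_coeff_0_iff coeff_map_poly complex_cnj_zero_iff complex_cnj_zero)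
  ultimately have "a * map_poly cnj a = b * map_poly cnj b"
    using \<open>g \<noteq> 0\<close> by simp
  then have "complex_of_real ((cmod (poly a (of_real x)))\<^sup>2) = of_real ((cmod (poly b (of_real x)))\<^sup>2)" for x :: real
    unfolding complex_norm_square
    by (metis complex_cnj_complex_of_real poly_map_poly_cnj poly_mult)
  then have norm_eq: "cmod (poly a (of_real x)) = cmod (poly b (of_real x))" for x :: real
    by (metis norm_ge_zero of_real_eq_iff power2_eq_imp_eq)
  \<comment> \<open>A real zero of \<open>b\<close> would be a zero of \<open>a\<close> too, since
    the moduli agree, contradicting coprimality.\<close>
  have ne: "poly b (of_real x) \<noteq> 0" for x :: real
  proof
    assume b0: "poly b (of_real x) = 0"
    then have "poly a (of_real x) = 0"
      using norm_eq[of x] by simp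
    moreover obtain u v where "u * a + v * b = 1"
      using coprime_poly_bezout[OF ab(3)] .
    ultimately show False
      using b0 by (metis add.right_neutral mult_zero_right poly_1 poly_add poly_mult zero_neq_one)
  qed
  \<comment> \<open>Substitution of \<open>- \<i> * z\<close>, which carries the imaginary axis back
    to the real line.\<close>
  define l where "l = [:0, - \<i>:]"
  have l: "pcompose p l = 0 \<longleftrightarrow> p = 0" "degree (pcompose p l) = degree p" 
    "poly (pcompose p l) (\<i> * of_real x) = poly p (of_real x)" for p x
    by (auto simp: l_def poly_pcompose pcompose_eq_0_iff degree_pcompose) (simp add: algebra_simps)
  define r where "r = (\<lambda>z. poly (pcompose a l) z / poly (pcompose b l) z)"
  have r: "r (\<i> * of_real x) = poly a (of_real x) / poly b (of_real x)" for x :: real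
    by (simp add: r_def l)
  show thesis
  proof
    have "degree b \<le> n" "degree a \<le> n"
      using ab(1,2) \<open>P \<noteq> 0\<close> \<open>P' \<noteq> 0\<close> assms(1) degree_map_poly_cnj[of P]
      unfolding P'_def[symmetric] by (metis degree_mult_right_le mult_zero_right order_trans mult_zero_left dvd_imp_degree_le dvd_triv_left)+
    moreover have "coprime (pcompose a l) (pcompose b l)"
      by (rule coprime_pcompose) fact
    moreover have "b \<noteq> 0" using ab(2) \<open>P \<noteq> 0\<close> by auto
    ultimately have "r \<in> rational_functions n"
      unfolding rational_functions_def mem_Collect_eq
      by (intro exI[of _ "pcompose a l"] exI[of _ "pcompose b l"]) (simp add: l r_def)
    then show "r \<in> unitary_functions n"
      using ne norm_eq by (simp add: unitary_functions_def r norm_divide)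
  next
    fix x :: real assume "poly P (of_real x) \<noteq> 0"
    then show "r (\<i> * of_real x) = cnj (poly P (of_real x)) / poly P (of_real x)"
      unfolding ev(1) unfolding ev(2) by (auto simp: r)
  qed
qed

section \<open>Phase errors\<close>

text \<open>
  If \<open>r = cnj P / P\<close> on the imaginary axis and \<open>A\<close> denotes \<open>twist \<omega> P\<close>, then \<open>r / exp (\<omega> * z) = cnj A / A\<close>
  there, so the phase error is \<open>-2 * arg A\<close>, and the error is less than 2 where \<open>Re A \<noteq> 0\<close>.
\<close>

definition twist :: "real \<Rightarrow> complex poly \<Rightarrow> real \<Rightarrow> complex" where
  "twist \<omega> P x = poly P (of_real x) * cis (\<omega> * x / 2)"

lemma twist_eq_0_iff: "twist \<omega> P x = 0 \<longleftrightarrow> poly P (of_real x) = 0"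
  by (simp add: twist_def)

text \<open>The unimodular factors cancel, so comparing two phase errors becomes a question about
  polynomials.\<close>

lemma cnj_twist_mult: "cnj (twist \<omega> P x) * twist \<omega> Q x = cnj (poly P (of_real x)) * poly Q (of_real x)"
  by (simp add: twist_def mult.left_commute cis_mult cis_cnj mult.assoc)

lemma twist_smult: "twist \<omega> (smult c P) x = c * twist \<omega> P x"
  and twist_diff: "twist \<omega> (P - Q) x = twist \<omega> P x - twist \<omega> Q x"
  by (simp_all add: twist_def algebra_simps)

lemma continuous_on_twist [continuous_intros]: "continuous_on S (twist \<omega> P)"
  unfolding twist_def cis_conv_exp by (intro continuous_intros) auto

lemma twist_has_vector_derivative:
  "(twist \<omega> P has_vector_derivative
     (poly (pderiv P) (of_real x) + \<i> * of_real (\<omega> / 2) * poly P (of_real x)) * cis (\<omega> * x / 2)) (at x)"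
proof -
  define f where "f = (\<lambda>z. poly P z * exp (\<i> * of_real (\<omega> / 2) * z))"
  have f: "twist \<omega> P = (\<lambda>x. f (of_real x))"
    by (simp add: fun_eq_iff f_def twist_def cis_conv_exp mult.assoc)
  have "(f has_field_derivative
      (poly (pderiv P) (of_real x) + \<i> * of_real (\<omega> / 2) * poly P (of_real x)) * cis (\<omega> * x / 2)) (at (of_real x))"
    unfolding f_def by (auto intro!: derivative_eq_intros poly_DERIV simp: cis_conv_exp algebra_simps)
  then show ?thesis
    unfolding f by (rule has_vector_derivative_real_field)
qed

text \<open>With \<open>A\<close> denoting \<open>twist \<omega> P x\<close>, dividing by
  \<open>cis (\<omega> * x)\<close> turns the error into the modulus of
  \<open>cnj A / A - 1\<close>, that is, of \<open>(cnj A - A) / A\<close>.\<close>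

lemma pointwise_error_twist:
  assumes "r (\<i> * of_real x) = cnj (poly P (of_real x)) / poly P (of_real x)" "poly P (of_real x) \<noteq> 0"
  shows "pointwise_error \<omega> r x = 2 * \<bar>Im (twist \<omega> P x)\<bar> / cmod (twist \<omega> P x)"
proof -
  define c where "c = cis (\<omega> * x / 2)"
  define p where "p = poly P (of_real x)"
  have c: "cmod c = 1" "cis (\<omega> * x) = c * c" "cnj c * c = 1" "c \<noteq> 0"
    by (simp_all add: c_def cis_mult cis_cnj)
  have "p \<noteq> 0" using assms by (simp add: p_def)
  have "r (\<i> * of_real x) - cis (\<omega> * x) = c * ((cnj c * c) * cnj p - p * c * c) / (p * c)"
    unfolding c(2,3) assms(1) p_def[symmetric] using c(4) \<open>p \<noteq> 0\<close> by (simp add: field_simps)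
  also have "\<dots> = c * c * (cnj (p * c) - p * c) / (p * c)"
    by (simp add: algebra_simps)
  finally have "pointwise_error \<omega> r x = cmod (cnj (p * c) - p * c) / cmod (p * c)"
    unfolding pointwise_error_def by (simp add: norm_mult norm_divide c(1))
  also have "cmod (cnj (p * c) - p * c) = 2 * \<bar>Im (p * c)\<bar>"
    by (subst norm_minus_commute) (simp add: complex_diff_cnj norm_mult del: complex_cnj_mult times_complex.sel)
  finally show ?thesis
    by (simp add: twist_def p_def c_def)
qed

lemma approx_error_eq: "approx_error \<omega> r = (SUP x\<in>{-1..1}. pointwise_error \<omega> r x)"
  unfolding approx_error_def imag_norm_def pointwise_error_def by (simp add: cis_conv_exp mult_ac)

lemma approx_error_le:
  "(\<And>x. x \<in> {-1..1} \<Longrightarrow> pointwise_error \<omega> r x \<le> c) \<Longrightarrow> approx_error \<omega> r \<le> c"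
  unfolding approx_error_eq by (intro cSUP_least) auto

lemma pointwise_error_le:
  assumes "r \<in> unitary_functions n" "x \<in> {-1..1}"
  shows "pointwise_error \<omega> r x \<le> approx_error \<omega> r"
proof -
  have "pointwise_error \<omega> r y \<le> 2" for y
    using assms(1) norm_triangle_ineq4[of "r (\<i> * of_real y)" "cis (\<omega> * y)"]
    by (simp add: unitary_functions_def pointwise_error_def)
  then show ?thesis
    unfolding approx_error_eq by (intro cSUP_upper assms bdd_aboveI2)
qed

lemma approx_error_nonneg:
  assumes "r \<in> unitary_functions n" shows "0 \<le> approx_error \<omega> r"
  using pointwise_error_le[OF assms, of 0 \<omega>] by (simp add: pointwise_error_def) (meson norm_ge_zero order_trans)

text \<open>After squaring, the common product of squared imaginary parts cancels. For arguments in
  the right half-plane this says that sines and tangents are ordered alike; the cross-multiplied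
  form also covers zero.\<close>

lemma Im_ratio_le_iff:
  "\<bar>Im b\<bar> * cmod a \<le> \<bar>Im a\<bar> * cmod b \<longleftrightarrow> \<bar>Im b\<bar> * \<bar>Re a\<bar> \<le> \<bar>Im a\<bar> * \<bar>Re b\<bar>"
proof -
  have "\<bar>Im b\<bar> * cmod a \<le> \<bar>Im a\<bar> * cmod b \<longleftrightarrow> (\<bar>Im b\<bar> * cmod a)\<^sup>2 \<le> (\<bar>Im a\<bar> * cmod b)\<^sup>2"
    by (simp add: power_mono_iff)
  also have "\<dots> \<longleftrightarrow> (\<bar>Im b\<bar> * \<bar>Re a\<bar>)\<^sup>2 \<le> (\<bar>Im a\<bar> * \<bar>Re b\<bar>)\<^sup>2"
    by (simp add: power_mult_distrib cmod_power2 algebra_simps)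
  also have "\<dots> \<longleftrightarrow> \<bar>Im b\<bar> * \<bar>Re a\<bar> \<le> \<bar>Im a\<bar> * \<bar>Re b\<bar>"
    by (simp add: power_mono_iff)
  finally show ?thesis .
qed

lemma Im_ratio_less_iff:
  "\<bar>Im b\<bar> * cmod a < \<bar>Im a\<bar> * cmod b \<longleftrightarrow> \<bar>Im b\<bar> * \<bar>Re a\<bar> < \<bar>Im a\<bar> * \<bar>Re b\<bar>"
  using Im_ratio_le_iff[of a b] by linarith

text \<open>In the right half-plane, \<open>Im (cnj b * a)\<close> has the sign of the difference of
  the arguments. If the argument of \<open>a\<close> dominates in modulus, its sign
  \<open>\<sigma>\<close> decides.\<close>

lemma Im_cnj_mult_sign:
  assumes "0 \<le> Re a" "0 \<le> Re b" "\<sigma> = 1 \<or> \<sigma> = (-1::real)" "0 \<le> \<sigma> * Im a"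
  shows "\<bar>Im b\<bar> * cmod a \<le> \<bar>Im a\<bar> * cmod b \<Longrightarrow> 0 \<le> \<sigma> * Im (cnj b * a)"
    and "\<bar>Im b\<bar> * cmod a < \<bar>Im a\<bar> * cmod b \<Longrightarrow> 0 < \<sigma> * Im (cnj b * a)"
proof -
  have "\<bar>Im a\<bar> = \<sigma> * Im a"
    using assms(3,4) by auto
  moreover have "\<sigma> * (Im b * Re a) \<le> \<bar>Im b\<bar> * Re a"
    using assms(3) assms(1) by (auto simp: mult_right_mono minus_le_iff) (metis abs_ge_minus_self mult_minus_left mult_right_mono)
  ultimately have *: "\<bar>Im a\<bar> * Re b - \<bar>Im b\<bar> * Re a \<le> \<sigma> * Im (cnj b * a)"
    by (simp add: algebra_simps)
  show "\<bar>Im b\<bar> * cmod a \<le> \<bar>Im a\<bar> * cmod b \<Longrightarrow> 0 \<le> \<sigma> * Im (cnj b * a)"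
    unfolding Im_ratio_le_iff using * assms(1,2) by simp
  show "\<bar>Im b\<bar> * cmod a < \<bar>Im a\<bar> * cmod b \<Longrightarrow> 0 < \<sigma> * Im (cnj b * a)"
    unfolding Im_ratio_less_iff using * assms(1,2) by simp
qed

text \<open>A zero of \<open>Re (twist \<omega> P x)\<close> would make the error equal to 2. Hence
  this real part has constant sign on \<open>[-1, 1]\<close>, and replacing \<open>P\<close> by
  \<open>- P\<close> makes it positive without changing the quotient.\<close>

lemma unitary_representation:
  assumes "r \<in> unitary_functions n" "approx_error \<omega> r < 2"
  obtains P where "degree P \<le> n" "coprime P (map_poly cnj P)"
    "\<And>x::real. poly P (of_real x) \<noteq> 0"
    "\<And>x::real. r (\<i> * of_real x) = cnj (poly P (of_real x)) / poly P (of_real x)"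
    "\<And>x. x \<in> {-1..1} \<Longrightarrow> 0 < Re (twist \<omega> P x)"
proof -
  obtain P where P: "degree P \<le> n" "coprime P (map_poly cnj P)"
    "\<And>x::real. poly P (of_real x) \<noteq> 0"
    "\<And>x::real. r (\<i> * of_real x) = cnj (poly P (of_real x)) / poly P (of_real x)"
    using unitary_imp_conj_quotient[OF assms(1)] by blast
  have Re0: "Re (twist \<omega> P x) \<noteq> 0" if "x \<in> {-1..1}" for x
  proof
    assume "Re (twist \<omega> P x) = 0"
    then have "\<bar>Im (twist \<omega> P x)\<bar> = cmod (twist \<omega> P x)"
      by (simp add: cmod_def)
    then have "pointwise_error \<omega> r x = 2"
      using pointwise_error_twist[where r = r and P = P and x = x and \<omega> = \<omega>, OF P(4,3)] P(3)[of x] by (simp add: twist_eq_0_iff)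
    then show False
      using pointwise_error_le[OF assms(1) that, of \<omega>] assms(2) by simp
  qed
  have conn: "connected ((\<lambda>x. Re (twist \<omega> P x)) ` {-1..1})"
    by (intro connected_continuous_image continuous_intros) simp
  have "(\<forall>x\<in>{-1..1}. 0 < Re (twist \<omega> P x)) \<or> (\<forall>x\<in>{-1..1}. Re (twist \<omega> P x) < 0)"
  proof (rule ccontr)
    assume "\<not> ?thesis"
    then obtain y z where "y \<in> {-1..1}" "Re (twist \<omega> P y) \<le> 0" "z \<in> {-1..1}" "0 \<le> Re (twist \<omega> P z)"
      by (meson not_le)
    then have "0 \<in> (\<lambda>x. Re (twist \<omega> P x)) ` {-1..1}"
      using conn unfolding connected_iff_interval by blast
    then show False using Re0 by force
  qed
  then show thesis
  proof
    assume "\<forall>x\<in>{-1..1}. 0 < Re (twist \<omega> P x)"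
    then show thesis using that P by blast
  next
    assume neg: "\<forall>x\<in>{-1..1}. Re (twist \<omega> P x) < 0"
    have "map_poly cnj (- P) = - map_poly cnj P"
      by (rule poly_eqI) (simp add: coeff_map_poly)
    then show thesis
      using that[of "- P"] P neg by (simp add: twist_def)
  qed
qed

text \<open>On the real line the imaginary part is a real polynomial of degree at most
  \<open>2 * n\<close>, too small for \<open>2 * n + 2\<close> points of weak alternation.\<close>

lemma alternation_imp_Im_zero:
  assumes "degree P \<le> n" "degree Q \<le> n" "strict_mono_on {..2*n+1} \<xi>" "s = 1 \<or> s = (-1::real)"
    and alt: "\<And>k. k \<le> 2*n+1 \<Longrightarrow>
      0 \<le> s * (-1) ^ k * Im (cnj (poly P (of_real (\<xi> k))) * poly Q (of_real (\<xi> k)))"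
  shows "Im (cnj (poly P (of_real x)) * poly Q (of_real x)) = 0"
proof -
  define D where "D = smult s (map_poly Im (map_poly cnj P * Q))"
  have D: "poly D y = s * Im (cnj (poly P (of_real y)) * poly Q (of_real y))" for y
    by (simp add: D_def poly_map_poly_Im)
  have "degree D \<le> degree (map_poly cnj P * Q)"
    unfolding D_def by (intro order_trans[OF degree_smult_le] degree_map_poly_Im_le)
  also have "\<dots> \<le> degree (map_poly cnj P) + degree Q"
    by (rule degree_mult_le)
  also have "\<dots> \<le> 2 * n"
    using assms(1,2) by (simp add: degree_map_poly_cnj)
  finally have "D = 0"
    using assms(3) alt by (intro alternating_sign_imp_zero[of D "2*n" \<xi>]) (simp_all add: D mult_ac)
  then show ?thesis
    using D[of x] assms(4) by auto
qed

text \<open>Where \<open>g\<close> is positive every \<open>t > 0\<close> works. The rest of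
  \<open>K\<close> is compact and \<open>f\<close> is negative there, hence bounded away from
  0.\<close>

lemma small_perturbation:
  fixes f g :: "'a::metric_space \<Rightarrow> real"
  assumes "compact K" "continuous_on K f" "continuous_on K g"
    and f: "\<And>x. x \<in> K \<Longrightarrow> f x \<le> 0" and g: "\<And>x. x \<in> K \<Longrightarrow> f x = 0 \<Longrightarrow> 0 < g x"
  obtains t0 where "0 < t0" "\<And>t x. 0 < t \<Longrightarrow> t < t0 \<Longrightarrow> x \<in> K \<Longrightarrow> f x - t * g x < 0"
proof (cases "K \<inter> g -` {..0} = {}")
  case True
  have "f x - t * g x < 0" if "0 < t" "x \<in> K" for t x
  proof -
    have "0 < g x" using True that(2) by (auto simp: not_le)
    then show ?thesis using f[OF that(2)] that(1) mult_pos_pos[of t "g x"] by linarith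
  qed
  then show thesis
    by (intro that[of 1]) auto
next
  case False
  define L where "L = K \<inter> g -` {..0}"
  have "closed L"
    unfolding L_def using assms(1,3) by (auto intro!: continuous_closed_preimage intro: compact_imp_closed)
  then have "compact L"
    using compact_Int_closed[OF assms(1), of L] by (simp add: L_def Int_absorb1)
  have "L \<noteq> {}" "L \<subseteq> K" "\<And>x. x \<in> L \<Longrightarrow> g x \<le> 0"
    using False by (auto simp: L_def)
  obtain a where a: "a \<in> L" "\<And>x. x \<in> L \<Longrightarrow> f x \<le> f a"
    using continuous_attains_sup[OF \<open>compact L\<close> \<open>L \<noteq> {}\<close>] continuous_on_subset[OF assms(2) \<open>L \<subseteq> K\<close>]
    by blast
  obtain b where b: "b \<in> L" "\<And>x. x \<in> L \<Longrightarrow> g b \<le> g x"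
    using continuous_attains_inf[OF \<open>compact L\<close> \<open>L \<noteq> {}\<close>] continuous_on_subset[OF assms(3) \<open>L \<subseteq> K\<close>]
    by blast
  have "f a < 0"
    using f[of a] g[of a] a(1) by (force simp: L_def)
  have gb: "g b \<le> 0"
    using b(1) by (simp add: L_def)
  show thesis
  \<comment> \<open>Extreme values \<open>f a\<close> and \<open>g b\<close> are combined; the
    summand 1 keeps the denominator positive even if \<open>g b = 0\<close>.\<close>
  proof (rule that[of "- f a / (1 - g b)"])
    show "0 < - f a / (1 - g b)"
      using \<open>f a < 0\<close> gb by (intro divide_pos_pos) auto
  next
    fix t x assume t: "0 < t" "t < - f a / (1 - g b)" and x: "x \<in> K"
    show "f x - t * g x < 0"
    proof (cases "x \<in> L")
      case True
      have "t * (1 - g b) < - f a"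
        using t(2) gb by (simp add: field_simps)
      moreover have "t * g b \<le> t * g x"
        using t(1) b(2)[OF True] by simp
      ultimately show ?thesis
        using a(2)[OF True] t(1) unfolding right_diff_distrib by linarith
    next
      case False
      then have "0 < g x" using x by (auto simp: L_def)
      then show ?thesis using f[OF x] t(1) mult_pos_pos[of t "g x"] by linarith
    qed
  qed
qed

section \<open>Alternation of the best approximant\<close>

text \<open>
  With \<open>B\<close> denoting \<open>twist \<omega> Q\<close>, this is \<open>Im (cnj B * B')\<close>, the numerator of the derivative of \<open>arg B\<close>.
\<close>

definition twist_wronskian :: "real \<Rightarrow> complex poly \<Rightarrow> real poly" where
  "twist_wronskian \<omega> Q = map_poly Im (map_poly cnj Q * pderiv Q + smult (\<i> * of_real (\<omega> / 2)) (map_poly cnj Q * Q))"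

lemma degree_twist_wronskian: "degree (twist_wronskian \<omega> Q) \<le> 2 * degree Q"
  unfolding twist_wronskian_def
proof (intro order_trans[OF degree_map_poly_Im_le] degree_add_le order_trans[OF degree_smult_le])
  show "degree (map_poly cnj Q * pderiv Q) \<le> 2 * degree Q"
    using degree_mult_le[of "map_poly cnj Q" "pderiv Q"] by (simp add: degree_map_poly_cnj degree_pderiv)
  show "degree (map_poly cnj Q * Q) \<le> 2 * degree Q"
    using degree_mult_le[of "map_poly cnj Q" "Q"] by (simp add: degree_map_poly_cnj)
qed

text \<open>The coefficient at twice the degree of \<open>Q\<close> comes only from the term with
  \<open>\<omega> / 2\<close>, because differentiation lowers the degree or gives 0.\<close>

lemma twist_wronskian_nonzero:
  assumes "Q \<noteq> 0" "\<omega> \<noteq> 0"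
  shows "twist_wronskian \<omega> Q \<noteq> 0"
proof -
  define m where "m = degree Q"
  have "coeff (map_poly cnj Q * pderiv Q) (m + m) = 0"
  proof (cases "m = 0")
    case True
    then show ?thesis
      by (auto simp: m_def elim!: degree_eq_zeroE)
  next
    case False
    then have "degree (map_poly cnj Q * pderiv Q) < m + m"
      using degree_mult_le[of "map_poly cnj Q" "pderiv Q"] by (simp add: degree_map_poly_cnj degree_pderiv m_def)
    then show ?thesis by (rule coeff_eq_0)
  qed
  moreover have "coeff (map_poly cnj Q * Q) (m + m) = of_real ((cmod (lead_coeff Q))\<^sup>2)"
    using coeff_mult_degree_sum[of "map_poly cnj Q" Q]
    by (simp add: degree_map_poly_cnj coeff_map_poly m_def complex_norm_square mult.commute
        del: of_real_power)
  ultimately have "coeff (twist_wronskian \<omega> Q) (m + m) = \<omega> / 2 * (cmod (lead_coeff Q))\<^sup>2"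
    by (simp add: twist_wronskian_def coeff_map_poly)
  then show ?thesis
    using assms by (metis coeff_0 leading_coeff_0_iff mult_eq_0_iff norm_eq_zero power_eq_0_iff divide_eq_0_iff zero_neq_numeral)
qed

lemma twist_extremum_imp_root:
  assumes "\<xi> \<in> {-1<..<1}" and Re: "\<And>x. x \<in> {-1..1} \<Longrightarrow> 0 < Re (twist \<omega> Q x)"
    and bound: "\<And>x. x \<in> {-1..1} \<Longrightarrow> \<bar>Im (twist \<omega> Q x)\<bar> \<le> \<tau> * Re (twist \<omega> Q x)"
    and eq: "\<bar>Im (twist \<omega> Q \<xi>)\<bar> = \<tau> * Re (twist \<omega> Q \<xi>)"
  shows "poly (twist_wronskian \<omega> Q) \<xi> = 0"
proof -
  let ?B = "twist \<omega> Q"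
  \<comment> \<open>The sign of \<open>k x\<close> compares the arguments of
    \<open>twist \<omega> Q\<close> at \<open>x\<close> and \<open>\<xi>\<close>. So
    \<open>k\<close> has a local extremum at \<open>\<xi>\<close>, and its derivative there is the
    value of \<open>twist_wronskian\<close>.\<close>
  define k where "k = (\<lambda>x. Im (cnj (?B \<xi>) * ?B x))"
  let ?D = "(poly (pderiv Q) (of_real \<xi>) + \<i> * of_real (\<omega> / 2) * poly Q (of_real \<xi>)) * cis (\<omega> * \<xi> / 2)"
  have "((\<lambda>x. cnj (?B \<xi>) * ?B x) has_vector_derivative cnj (?B \<xi>) * ?D) (at \<xi>)"
    by (intro has_vector_derivative_mult_right twist_has_vector_derivative)
  then have "(k has_real_derivative Im (cnj (?B \<xi>) * ?D)) (at \<xi>)"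
    unfolding k_def by (rule has_field_derivative_Im)
  also have "cnj (?B \<xi>) * ?D = cnj (poly Q (of_real \<xi>)) * (poly (pderiv Q) (of_real \<xi>) + \<i> * of_real (\<omega> / 2) * poly Q (of_real \<xi>))"
    by (simp add: twist_def mult_ac cis_mult cis_cnj)
  also have "Im \<dots> = poly (twist_wronskian \<omega> Q) \<xi>"
    unfolding twist_wronskian_def poly_map_poly_Im
    by (intro arg_cong[of _ _ Im]) (simp add: algebra_simps)
  finally have der: "(k has_real_derivative poly (twist_wronskian \<omega> Q) \<xi>) (at \<xi>)" .
  define d where "d = min (1 - \<xi>) (\<xi> + 1)"
  have "0 < d" using assms(1) by (simp add: d_def)
  have ball: "y \<in> {-1..1}" if "\<bar>\<xi> - y\<bar> < d" for y
    using that by (auto simp: d_def)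
  have \<xi>: "\<xi> \<in> {-1..1}" using assms(1) by auto
  have k0: "k \<xi> = 0" by (simp add: k_def)
  show ?thesis
  proof (cases "0 \<le> Im (?B \<xi>)")
    case True
    have "k y \<le> k \<xi>" if "\<bar>\<xi> - y\<bar> < d" for y
    proof -
      have "k y = Re (?B \<xi>) * (Im (?B y) - \<tau> * Re (?B y))"
        using True eq by (simp add: k_def algebra_simps)
      moreover have "Im (?B y) - \<tau> * Re (?B y) \<le> 0"
        using bound[OF ball[OF that]] by auto
      ultimately show ?thesis
        using Re[OF \<xi>] by (simp add: k0 mult_nonneg_nonpos)
    qed
    then show ?thesis
      using DERIV_local_max[OF der \<open>0 < d\<close>] by blast
  next
    case False
    have "k \<xi> \<le> k y" if "\<bar>\<xi> - y\<bar> < d" for y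
    proof -
      have "Im (?B \<xi>) = - \<tau> * Re (?B \<xi>)"
        using False eq by simp
      then have "k y = Re (?B \<xi>) * (Im (?B y) + \<tau> * Re (?B y))"
        by (simp add: k_def algebra_simps)
      moreover have "0 \<le> Im (?B y) + \<tau> * Re (?B y)"
        using bound[OF ball[OF that]] by auto
      ultimately show ?thesis
        using Re[OF \<xi>] by (simp add: k0)
    qed
    then show ?thesis
      using DERIV_local_min[OF der \<open>0 < d\<close>] by blast
  qed
qed

text \<open>For the denominator \<open>Q - t * H\<close>, the two one-sided bounds on the imaginary
  part are affine in \<open>t\<close>, so \<open>small_perturbation\<close> applies to each
  sign.\<close>

lemma separation_imp_improvement:
  assumes Q: "degree Q \<le> n" "degree H \<le> n"
    and Re: "\<And>x. x \<in> {-1..1} \<Longrightarrow> 0 < Re (twist \<omega> Q x)"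
    and bound: "\<And>x. x \<in> {-1..1} \<Longrightarrow> \<bar>Im (twist \<omega> Q x)\<bar> \<le> \<tau> * Re (twist \<omega> Q x)"
    and pos: "\<And>x. x \<in> {-1..1} \<Longrightarrow> Im (twist \<omega> Q x) = \<tau> * Re (twist \<omega> Q x) \<Longrightarrow>
      0 < Im (cnj (poly Q (of_real x)) * poly H (of_real x))"
    and neg: "\<And>x. x \<in> {-1..1} \<Longrightarrow> Im (twist \<omega> Q x) = - \<tau> * Re (twist \<omega> Q x) \<Longrightarrow>
      Im (cnj (poly Q (of_real x)) * poly H (of_real x)) < 0"
  obtains P where "degree P \<le> n"
    "\<And>x. x \<in> {-1..1} \<Longrightarrow> \<bar>Im (twist \<omega> P x)\<bar> < \<tau> * Re (twist \<omega> P x)"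
proof -
  let ?B = "twist \<omega> Q" and ?C = "twist \<omega> H"
  define f where "f = (\<lambda>s x. s * Im (?B x) - \<tau> * Re (?B x))"
  define g where "g = (\<lambda>s x. s * Im (?C x) - \<tau> * Re (?C x))"
  have cont: "continuous_on {-1..1} (f s)" "continuous_on {-1..1} (g s)" for s
    unfolding f_def g_def by (intro continuous_intros)+
  have f: "f s x \<le> 0" if "x \<in> {-1..1}" "s = 1 \<or> s = -1" for s x
    using bound[OF that(1)] that(2) by (auto simp: f_def)
  have g: "0 < g s x" if x: "x \<in> {-1..1}" and s: "s = 1 \<or> s = -1" and "f s x = 0" for s x
  proof -
    have eq: "Im (?B x) = s * \<tau> * Re (?B x)"
      using s \<open>f s x = 0\<close> by (auto simp: f_def)
    \<comment> \<open>Multiplying by \<open>Re (?B x)\<close> and substituting the extremality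
      equation turns \<open>g\<close> into the expression whose sign is prescribed.\<close>
    have "Re (?B x) * g s x = s * Im (cnj (?B x) * ?C x)"
      using s by (auto simp: eq g_def algebra_simps)
    also have "\<dots> = s * Im (cnj (poly Q (of_real x)) * poly H (of_real x))"
      unfolding cnj_twist_mult ..
    also have "0 < \<dots>"
      using s pos[OF x] neg[OF x] eq by auto
    finally show ?thesis
      using Re[OF x] by (simp add: zero_less_mult_iff)
  qed
  obtain t1 where t1: "0 < t1" "\<And>t x. 0 < t \<Longrightarrow> t < t1 \<Longrightarrow> x \<in> {-1..1} \<Longrightarrow> f 1 x - t * g 1 x < 0"
    using small_perturbation[OF _ cont f g, of 1] by auto
  obtain t2 where t2: "0 < t2" "\<And>t x. 0 < t \<Longrightarrow> t < t2 \<Longrightarrow> x \<in> {-1..1} \<Longrightarrow> f (-1) x - t * g (-1) x < 0"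
    using small_perturbation[OF _ cont f g, of "-1"] by auto
  define t where "t = min t1 t2 / 2"
  have t: "0 < t" "t < t1" "t < t2"
    using t1(1) t2(1) by (auto simp: t_def)
  show thesis
  proof
    show "degree (Q - smult (of_real t) H) \<le> n"
      using Q by (intro degree_diff_le order_trans[OF degree_smult_le])
  next
    fix x :: real assume x: "x \<in> {-1..1}"
    have "f 1 x - t * g 1 x < 0" "f (-1) x - t * g (-1) x < 0"
      using t1(2) t2(2) t x by blast+
    then show "\<bar>Im (twist \<omega> (Q - smult (of_real t) H) x)\<bar> < \<tau> * Re (twist \<omega> (Q - smult (of_real t) H) x)"
      by (simp add: twist_diff twist_smult f_def g_def algebra_simps abs_less_iff)
  qed
qed

text \<open>The supremum is attained where the tangent of half the phase error is largest in
  modulus. Hence a strict bound at every point gives a strict bound on the norm.\<close>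

lemma approx_error_representation:
  assumes r: "r \<in> unitary_functions n"
    and rP: "\<And>x. x \<in> {-1..1} \<Longrightarrow> r (\<i> * of_real x) = cnj (poly P (of_real x)) / poly P (of_real x)"
    and P: "\<And>x. x \<in> {-1..1} \<Longrightarrow> 0 < Re (twist \<omega> P x)"
  obtains x where "x \<in> {-1..1}" "approx_error \<omega> r = pointwise_error \<omega> r x"
    "\<And>y. y \<in> {-1..1} \<Longrightarrow> \<bar>Im (twist \<omega> P y)\<bar> / Re (twist \<omega> P y) \<le> \<bar>Im (twist \<omega> P x)\<bar> / Re (twist \<omega> P x)"
proof -
  let ?h = "\<lambda>y. \<bar>Im (twist \<omega> P y)\<bar> / Re (twist \<omega> P y)"
  have "continuous_on {-1..1} ?h"
    using P by (intro continuous_intros) force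
  then obtain x where x: "x \<in> {-1..1}" "\<And>y. y \<in> {-1..1} \<Longrightarrow> ?h y \<le> ?h x"
    using continuous_attains_sup[of "{-1..1::real}" ?h] by auto
  have ne: "twist \<omega> P y \<noteq> 0" if "y \<in> {-1..1}" for y
    using P[OF that] by auto
  have err: "pointwise_error \<omega> r y = 2 * \<bar>Im (twist \<omega> P y)\<bar> / cmod (twist \<omega> P y)" if "y \<in> {-1..1}" for y
    using rP[OF that] ne[OF that] by (intro pointwise_error_twist) (auto simp: twist_eq_0_iff)
  have "pointwise_error \<omega> r y \<le> pointwise_error \<omega> r x" if "y \<in> {-1..1}" for y
  proof -
    have "\<bar>Im (twist \<omega> P y)\<bar> * \<bar>Re (twist \<omega> P x)\<bar> \<le> \<bar>Im (twist \<omega> P x)\<bar> * \<bar>Re (twist \<omega> P y)\<bar>"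
      using x(2)[OF that] P[OF that] P[OF x(1)] by (simp add: field_simps)
    then have "\<bar>Im (twist \<omega> P y)\<bar> * cmod (twist \<omega> P x) \<le> \<bar>Im (twist \<omega> P x)\<bar> * cmod (twist \<omega> P y)"
      unfolding Im_ratio_le_iff .
    then show ?thesis
      using ne[OF that] ne[OF x(1)] unfolding err[OF that] err[OF x(1)] by (simp add: field_simps)
  qed
  then have "approx_error \<omega> r = pointwise_error \<omega> r x"
    using pointwise_error_le[OF r x(1), of \<omega>] by (intro antisym approx_error_le)
  then show thesis
    using that x by blast
qed

lemma best_approximant_alternates:
  assumes best: "unitary_best_approximant n \<omega> r" and "\<omega> \<noteq> 0" and less2: "approx_error \<omega> r < 2"
    and Q: "degree Q \<le> n" "coprime Q (map_poly cnj Q)"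
    and rQ: "\<And>x::real. r (\<i> * of_real x) = cnj (poly Q (of_real x)) / poly Q (of_real x)"
    and Re: "\<And>x. x \<in> {-1..1} \<Longrightarrow> 0 < Re (twist \<omega> Q x)"
  obtains \<xi> s where "degree Q = n" "strict_mono_on {..2*n+1} \<xi>" "s = 1 \<or> s = (-1::real)"
    "\<And>k. k \<le> 2*n+1 \<Longrightarrow> \<xi> k \<in> {-1..1}"
    "\<And>k. k \<le> 2*n+1 \<Longrightarrow> 0 \<le> s * (-1) ^ k * Im (twist \<omega> Q (\<xi> k))"
    "\<And>k. k \<le> 2*n+1 \<Longrightarrow> 2 * \<bar>Im (twist \<omega> Q (\<xi> k))\<bar> = approx_error \<omega> r * cmod (twist \<omega> Q (\<xi> k))"
proof -
  let ?B = "twist \<omega> Q"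
  have r: "r \<in> unitary_functions n"
    and min: "\<And>s. s \<in> unitary_functions n \<Longrightarrow> approx_error \<omega> r \<le> approx_error \<omega> s"
    using best by (auto simp: unitary_best_approximant_def is_arg_min_def not_less)
  have ne: "?B x \<noteq> 0" if "x \<in> {-1..1}" for x
    using Re[OF that] by auto
  have "Q \<noteq> 0"
    using ne[of 0] by (auto simp: twist_def)
  obtain x0 where x0: "x0 \<in> {-1..1}" "approx_error \<omega> r = pointwise_error \<omega> r x0"
    "\<And>y. y \<in> {-1..1} \<Longrightarrow> \<bar>Im (?B y)\<bar> / Re (?B y) \<le> \<bar>Im (?B x0)\<bar> / Re (?B x0)"
    using approx_error_representation[OF r rQ Re] by blast
  \<comment> \<open>The largest modulus of the tangent of half the phase error.\<close>
  define \<tau> where "\<tau> = \<bar>Im (?B x0)\<bar> / Re (?B x0)"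
  have "0 \<le> \<tau>"
    using Re[OF x0(1)] by (simp add: \<tau>_def)
  have bound: "\<bar>Im (?B x)\<bar> \<le> \<tau> * Re (?B x)" if "x \<in> {-1..1}" for x
    using x0(3)[OF that] Re[OF that] unfolding \<tau>_def[symmetric] by (simp add: pos_divide_le_eq)
  have Im0: "\<bar>Im (?B x0)\<bar> = \<tau> * Re (?B x0)"
    using Re[OF x0(1)] by (simp add: \<tau>_def)
  have E: "approx_error \<omega> r = 2 * \<bar>Im (?B x0)\<bar> / cmod (?B x0)"
    unfolding x0(2) using rQ ne[OF x0(1)] by (intro pointwise_error_twist) (auto simp: twist_eq_0_iff)
  have root: "poly (twist_wronskian \<omega> Q) \<xi> = 0" if "\<xi> \<in> {-1<..<1}" "\<bar>Im (?B \<xi>)\<bar> = \<tau> * Re (?B \<xi>)" for \<xi>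
    using twist_extremum_imp_root[OF that(1) Re bound that(2)] .
  note W0 = twist_wronskian_nonzero[OF \<open>Q \<noteq> 0\<close> \<open>\<omega> \<noteq> 0\<close>]
  \<comment> \<open>Otherwise every interior point is extremal and the nonzero polynomial
    \<open>twist_wronskian \<omega> Q\<close> vanishes on an interval.\<close>
  have "\<tau> \<noteq> 0"
  proof
    assume "\<tau> = 0"
    then have "{-1<..<1} \<subseteq> {x. poly (twist_wronskian \<omega> Q) x = 0}"
      using root bound by (auto simp: subset_iff)
    moreover have "infinite {-1<..<1::real}" by (simp add: infinite_Ioo)
    ultimately show False
      using poly_roots_finite[OF W0] finite_subset by blast
  qed
  then have "0 < \<tau>" using \<open>0 \<le> \<tau>\<close> by simp
  define Ap where "Ap = {-1..1} \<inter> (\<lambda>x. Im (?B x) - \<tau> * Re (?B x)) -` {0}"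
  define Am where "Am = {-1..1} \<inter> (\<lambda>x. Im (?B x) + \<tau> * Re (?B x)) -` {0}"
  have "closed Ap" "closed Am"
    unfolding Ap_def Am_def by (intro continuous_closed_preimage continuous_intros; simp)+
  then have compact: "compact Ap" "compact Am"
    using compact_Int_closed[of "{-1..1::real}"] by (metis Ap_def Am_def compact_Icc inf.left_idem)+
  have disj: "Ap \<inter> Am = {}"
  proof -
    have False if "x \<in> Ap" "x \<in> Am" for x
    proof -
      have "\<tau> * Re (?B x) = 0" "x \<in> {-1..1}"
        using that by (auto simp: Ap_def Am_def)
      then show False using Re[of x] \<open>0 < \<tau>\<close> by simp
    qed
    then show ?thesis by blast
  qed
  show thesis
  \<comment> \<open>The number is one more than the largest degree of \<open>w\<close> that
    \<open>conj_factor_solvable\<close> admits.\<close>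
  proof (rule alternation_or_separation[OF compact disj, of "n + degree Q + 1"])
    show "0 < n + degree Q + 1" by simp
  next
    fix \<xi> :: "nat \<Rightarrow> real" and s :: real
    assume mono: "strict_mono_on {..n + degree Q + 1} \<xi>" and s: "s = 1 \<or> s = -1"
      and alt: "\<And>k. k \<le> n + degree Q + 1 \<Longrightarrow> \<xi> k \<in> (if s * (-1) ^ k = 1 then Ap else Am)"
    have \<xi>: "\<xi> k \<in> {-1..1}" "Im (?B (\<xi> k)) = s * (-1) ^ k * \<tau> * Re (?B (\<xi> k))"
      if "k \<le> n + degree Q + 1" for k
    proof -
      have "s * (-1) ^ k = 1 \<or> s * (-1) ^ k = -1"
        using s by (cases "even k") auto
      then show "\<xi> k \<in> {-1..1}" "Im (?B (\<xi> k)) = s * (-1) ^ k * \<tau> * Re (?B (\<xi> k))"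
        using alt[OF that] by (auto simp: Ap_def Am_def split: if_splits)
    qed
    have abs: "\<bar>Im (?B (\<xi> k))\<bar> = \<tau> * Re (?B (\<xi> k))" if "k \<le> n + degree Q + 1" for k
      using \<xi>[OF that] s \<open>0 < \<tau>\<close> Re[OF \<xi>(1)[OF that]] by (auto simp: abs_mult power_abs)
    \<comment> \<open>The first and last alternation points may be endpoints of
      \<open>[-1, 1]\<close>; the others are interior, hence zeros of
      \<open>twist_wronskian \<omega> Q\<close>.\<close>
    have "\<xi> ` {1..n + degree Q} \<subseteq> {x. poly (twist_wronskian \<omega> Q) x = 0}"
    proof
      fix y assume "y \<in> \<xi> ` {1..n + degree Q}"
      then obtain k where k: "k \<in> {1..n + degree Q}" "y = \<xi> k" by blast
      have "\<xi> 0 < \<xi> k" "\<xi> k < \<xi> (n + degree Q + 1)"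
        using k(1) by (auto intro!: strict_mono_onD[OF mono])
      then have "\<xi> k \<in> {-1<..<1}"
        using \<xi>(1)[of 0] \<xi>(1)[of "n + degree Q + 1"] by auto
      then show "y \<in> {x. poly (twist_wronskian \<omega> Q) x = 0}"
        using root[of "\<xi> k"] abs[of k] k by auto
    qed
    then have "card (\<xi> ` {1..n + degree Q}) \<le> card {x. poly (twist_wronskian \<omega> Q) x = 0}"
      using poly_roots_finite[OF W0] by (rule card_mono[rotated])
    also have "\<dots> \<le> degree (twist_wronskian \<omega> Q)"
      by (rule card_poly_roots_bound[OF W0])
    also have "\<dots> \<le> 2 * degree Q"
      by (rule degree_twist_wronskian)
    finally have "card (\<xi> ` {1..n + degree Q}) \<le> 2 * degree Q" .
    moreover have "inj_on \<xi> {1..n + degree Q}"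
      by (rule inj_on_subset[OF strict_mono_on_imp_inj_on[OF mono]]) auto
    ultimately have deg: "degree Q = n"
      using Q(1) by (simp add: card_image)
    have N: "n + degree Q + 1 = 2*n+1" using deg by simp
    show thesis
    proof (rule that[OF deg mono[unfolded N] s])
      fix k assume k: "k \<le> 2*n+1"
      note \<xi>k = \<xi>[unfolded N, OF k] and absk = abs[unfolded N, OF k]
      show "\<xi> k \<in> {-1..1}" by fact
      have "s * (-1) ^ k * (s * (-1) ^ k) = 1"
        using s by (auto simp flip: power_mult_distrib)
      then have "s * (-1) ^ k * Im (?B (\<xi> k)) = \<tau> * Re (?B (\<xi> k))"
        unfolding \<xi>k(2) by (metis mult.assoc mult_1)
      then show "0 \<le> s * (-1) ^ k * Im (?B (\<xi> k))"
        using Re[OF \<xi>k(1)] \<open>0 < \<tau>\<close> by simp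
      have "\<bar>Im (?B (\<xi> k))\<bar> * cmod (?B x0) = \<bar>Im (?B x0)\<bar> * cmod (?B (\<xi> k))"
        by (intro antisym; unfold Im_ratio_le_iff)
           (use Re[OF \<xi>k(1)] Re[OF x0(1)] absk Im0 in simp_all)
      then show "2 * \<bar>Im (?B (\<xi> k))\<bar> = approx_error \<omega> r * cmod (?B (\<xi> k))"
        unfolding E using ne[OF x0(1)] by (simp add: field_simps)
    qed
  next
    \<comment> \<open>Separation is impossible: moving \<open>Q\<close> along the direction
      \<open>H\<close> obtained from \<open>w\<close> would yield a unitary function with smaller
      error.\<close>
    fix w :: "real poly"
    assume w: "degree w < n + degree Q + 1" "\<And>x. x \<in> Ap \<Longrightarrow> 0 < poly w x" "\<And>x. x \<in> Am \<Longrightarrow> poly w x < 0"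
    obtain H where H: "degree H \<le> n"
      "\<And>x::real. Im (cnj (poly Q (of_real x)) * poly H (of_real x)) = poly w x"
      using conj_factor_solvable[OF Q(2) \<open>Q \<noteq> 0\<close> Q(1), of w] w(1) by auto
    obtain P where P: "degree P \<le> n"
      "\<And>x. x \<in> {-1..1} \<Longrightarrow> \<bar>Im (twist \<omega> P x)\<bar> < \<tau> * Re (twist \<omega> P x)"
      by (rule separation_imp_improvement[OF Q(1) H(1) Re bound]; (simp only: H(2))?)
         (auto simp: Ap_def Am_def intro!: w(2,3))
    have ReP: "0 < Re (twist \<omega> P x)" if "x \<in> {-1..1}" for x
      using P(2)[OF that] \<open>0 < \<tau>\<close> by (smt (verit) zero_less_mult_iff)
    then have neP: "poly P (of_real x) \<noteq> 0" if "x \<in> {-1..1}" for x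
      using that by (metis less_irrefl twist_eq_0_iff zero_complex.sel(1))
    have "P \<noteq> 0"
      using neP[of 0] by auto
    obtain r' where r': "r' \<in> unitary_functions n"
      "\<And>x::real. poly P (of_real x) \<noteq> 0 \<Longrightarrow> r' (\<i> * of_real x) = cnj (poly P (of_real x)) / poly P (of_real x)"
      using conj_quotient_unitary[OF P(1) \<open>P \<noteq> 0\<close>] by blast
    obtain x1 where x1: "x1 \<in> {-1..1}" "approx_error \<omega> r' = pointwise_error \<omega> r' x1"
      using approx_error_representation[OF r'(1) r'(2)[OF neP] ReP] by blast
    have "\<bar>Im (twist \<omega> P x1)\<bar> * \<bar>Re (?B x0)\<bar> < \<bar>Im (?B x0)\<bar> * \<bar>Re (twist \<omega> P x1)\<bar>"
      using P(2)[OF x1(1)] ReP[OF x1(1)] Re[OF x0(1)] Im0 by simp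
    then have "\<bar>Im (twist \<omega> P x1)\<bar> * cmod (?B x0) < \<bar>Im (?B x0)\<bar> * cmod (twist \<omega> P x1)"
      unfolding Im_ratio_less_iff .
    moreover have E': "approx_error \<omega> r' = 2 * \<bar>Im (twist \<omega> P x1)\<bar> / cmod (twist \<omega> P x1)"
      unfolding x1(2) using r'(2)[OF neP] neP x1(1) by (intro pointwise_error_twist) auto
    ultimately have "approx_error \<omega> r' < approx_error \<omega> r"
      unfolding E E' using ne[OF x0(1)] neP[OF x1(1)] by (simp add: field_simps twist_eq_0_iff)
    then show thesis
      using min[OF r'(1)] by simp
  qed
qed

section \<open>Convergence of minimizing sequences\<close>

text \<open>Bolzano-Weierstrass is applied to one index after another; passing to a further
  subsequence preserves the limits already obtained.\<close>

lemma convergent_subseq_finite_family: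
  fixes f :: "nat \<Rightarrow> nat \<Rightarrow> complex"
  assumes "\<And>j i. cmod (f j i) \<le> C"
  obtains \<sigma> :: "nat \<Rightarrow> nat" where "strict_mono \<sigma>" "\<And>i. i \<le> n \<Longrightarrow> convergent (\<lambda>j. f (\<sigma> j) i)"
proof -
  have "\<exists>\<sigma> :: nat \<Rightarrow> nat. strict_mono \<sigma> \<and> (\<forall>i<m. convergent (\<lambda>j. f (\<sigma> j) i))" for m
  proof (induction m)
    case 0
    then show ?case by (intro exI[of _ id]) (auto simp: strict_mono_def)
  next
    case (Suc m)
    then obtain \<sigma> :: "nat \<Rightarrow> nat" where \<sigma>: "strict_mono \<sigma>" "\<And>i. i < m \<Longrightarrow> convergent (\<lambda>j. f (\<sigma> j) i)"
      by blast
    have "bounded (range (\<lambda>j. f (\<sigma> j) m))"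
      using assms by (auto simp: bounded_iff)
    then obtain l \<rho> where \<rho>: "strict_mono \<rho>" "((\<lambda>j. f (\<sigma> j) m) \<circ> \<rho>) \<longlonglongrightarrow> l"
      using bounded_imp_convergent_subsequence by blast
    have "convergent (\<lambda>j. f ((\<sigma> \<circ> \<rho>) j) i)" if "i < Suc m" for i
    proof (cases "i = m")
      case True
      then show ?thesis using \<rho>(2) by (auto simp: convergent_def o_def)
    next
      case False
      then show ?thesis
        using convergent_subseq_convergent[OF \<sigma>(2)[of i] \<rho>(1)] that by (simp add: o_def)
    qed
    then show ?case
      using strict_mono_o[OF \<sigma>(1) \<rho>(1)] by blast
  qed
  from this[of "Suc n"] show thesis
    using that by (auto simp: less_Suc_eq_le)
qed

text \<open>Only \<open>q\<close> is left in the denominator, since \<open>p\<close> and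
  \<open>cnj p\<close> have equal modulus. With \<open>q\<close> from the limit, no lower bound
  along the sequence is required.\<close>

lemma conj_quotient_diff_bound:
  fixes p q :: complex
  assumes "p \<noteq> 0" "q \<noteq> 0"
  shows "cmod (cnj p / p - cnj q / q) \<le> 2 * cmod (p - q) / cmod q"
proof -
  have "cnj p / p - cnj q / q = (cnj p * (q - p) + p * cnj (p - q)) / (p * q)"
    using assms by (simp add: field_simps)
  also have "cmod \<dots> \<le> (cmod p * cmod (p - q) + cmod p * cmod (p - q)) / (cmod p * cmod q)"
    unfolding norm_divide norm_mult[of p q]
    by (intro divide_right_mono order_trans[OF norm_triangle_ineq])
       (simp_all add: norm_mult norm_minus_commute del: complex_cnj_diff)
  also have "\<dots> = 2 * cmod (p - q) / cmod q"
    using assms by (simp add: field_simps)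
  finally show ?thesis .
qed

lemma limit_of_minimizing_sequence:
  assumes Q: "coprime Q (map_poly cnj Q)" "degree Q = n"
    and ReQ: "\<And>x. x \<in> {-1..1} \<Longrightarrow> 0 < Re (twist \<omega> Q x)"
    and mono: "strict_mono_on {..2*n+1} \<xi>" and s: "s = 1 \<or> s = (-1::real)"
    and \<xi>: "\<And>k. k \<le> 2*n+1 \<Longrightarrow> \<xi> k \<in> {-1..1}"
      "\<And>k. k \<le> 2*n+1 \<Longrightarrow> 0 \<le> s * (-1) ^ k * Im (twist \<omega> Q (\<xi> k))"
      "\<And>k. k \<le> 2*n+1 \<Longrightarrow> 2 * \<bar>Im (twist \<omega> Q (\<xi> k))\<bar> = e * cmod (twist \<omega> Q (\<xi> k))"
    and P: "\<And>j. degree (P j) \<le> n" "\<And>j x. x \<in> {-1..1} \<Longrightarrow> 0 < Re (twist \<omega> (P j) x)"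
    and err: "\<And>j x. x \<in> {-1..1} \<Longrightarrow> 2 * \<bar>Im (twist \<omega> (P j) x)\<bar> \<le> E j * cmod (twist \<omega> (P j) x)"
    and E: "E \<longlonglongrightarrow> e"
  obtains \<sigma> b where "strict_mono \<sigma>" "b \<longlonglongrightarrow> (0::real)"
    "\<And>j x. x \<in> {-1..1} \<Longrightarrow> cmod (cnj (poly (P (\<sigma> j)) (of_real x)) / poly (P (\<sigma> j)) (of_real x) -
        cnj (poly Q (of_real x)) / poly Q (of_real x)) \<le> b j"
proof -
  have neQ: "poly Q (of_real x) \<noteq> 0" if "x \<in> {-1..1}" for x
    using ReQ[OF that] by (metis less_irrefl twist_eq_0_iff zero_complex.sel(1))
  have neP: "poly (P j) (of_real x) \<noteq> 0" if "x \<in> {-1..1}" for x j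
    using P(2)[OF that, of j] by (metis less_irrefl twist_eq_0_iff zero_complex.sel(1))
  define S where "S = (\<lambda>j. \<Sum>i\<le>n. cmod (coeff (P j) i))"
  have S: "0 < S j" for j
  proof -
    have "P j \<noteq> 0" using neP[of 0 j] by auto
    then have "0 < cmod (lead_coeff (P j))" by simp
    also have "\<dots> \<le> S j"
      unfolding S_def using P(1) by (intro member_le_sum) auto
    finally show ?thesis .
  qed
  \<comment> \<open>A positive real factor changes neither the quotient nor the phase, and
    coefficient norms summing to 1 keep the limit \<open>L\<close> nonzero.\<close>
  define N where "N = (\<lambda>j. smult (of_real (1 / S j)) (P j))"
  have N: "degree (N j) \<le> n" "twist \<omega> (N j) x = of_real (1 / S j) * twist \<omega> (P j) x"
    "(\<Sum>i\<le>n. cmod (coeff (N j) i)) = 1" for j x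
    using P(1)[of j] S[of j]
    by (auto simp: N_def twist_smult norm_divide sum_divide_distrib[symmetric] S_def[symmetric])
       (simp add: S_def)
  have "cmod (coeff (N j) i) \<le> 1" for j i
  proof (cases "i \<le> n")
    case True
    then have "cmod (coeff (N j) i) \<le> (\<Sum>i\<le>n. cmod (coeff (N j) i))"
      by (intro member_le_sum) auto
    then show ?thesis by (simp add: N(3))
  next
    case False
    then show ?thesis using N(1)[of j] by (simp add: coeff_eq_0)
  qed
  then obtain \<sigma> :: "nat \<Rightarrow> nat" where \<sigma>: "strict_mono \<sigma>" "\<And>i. i \<le> n \<Longrightarrow> convergent (\<lambda>j. coeff (N (\<sigma> j)) i)"
    using convergent_subseq_finite_family[of "\<lambda>j. coeff (N j)" 1 n] by blast
  then obtain a where a: "\<And>i. i \<le> n \<Longrightarrow> (\<lambda>j. coeff (N (\<sigma> j)) i) \<longlonglongrightarrow> a i"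
    unfolding convergent_def by metis
  define L where "L = (\<Sum>i\<le>n. monom (a i) i)"
  have coeffL: "coeff L i = (if i \<le> n then a i else 0)" for i
    by (simp add: L_def coeff_sum coeff_monom)
  have "degree L \<le> n"
    by (rule degree_le) (simp add: coeffL)
  have diff: "cmod (poly (N (\<sigma> j)) (of_real x) - poly L (of_real x)) \<le> (\<Sum>i\<le>n. cmod (coeff (N (\<sigma> j)) i - a i))"
    if "x \<in> {-1..1}" for j x
  proof -
    have "poly p (of_real x) = (\<Sum>i\<le>n. coeff p i * of_real x ^ i)" if "degree p \<le> n" for p :: "complex poly"
      using arg_cong[OF poly_as_sum_of_monoms'[OF that], of "\<lambda>p. poly p (of_real x)"]
      by (simp add: poly_sum poly_monom)
    then have "poly (N (\<sigma> j)) (of_real x) - poly L (of_real x) = (\<Sum>i\<le>n. (coeff (N (\<sigma> j)) i - a i) * of_real x ^ i)"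
      using N(1) \<open>degree L \<le> n\<close> by (simp add: coeffL sum_subtractf left_diff_distrib)
    also have "cmod \<dots> \<le> (\<Sum>i\<le>n. cmod (coeff (N (\<sigma> j)) i - a i))"
    proof (intro sum_norm_le)
      fix i
      have "\<bar>x\<bar> ^ i \<le> 1"
        using that by (intro power_le_one) auto
      then show "cmod ((coeff (N (\<sigma> j)) i - a i) * of_real x ^ i) \<le> cmod (coeff (N (\<sigma> j)) i - a i)"
        by (simp add: norm_mult norm_power mult_left_le)
    qed
    finally show ?thesis .
  qed
  define \<kappa> where "\<kappa> = (\<lambda>j. \<Sum>i\<le>n. cmod (coeff (N (\<sigma> j)) i - a i))"
  have "(\<lambda>j. cmod (coeff (N (\<sigma> j)) i - a i)) \<longlonglongrightarrow> 0" if "i \<le> n" for i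
    using a[OF that] by (simp add: tendsto_norm_zero_iff LIM_zero_iff)
  then have \<kappa>: "\<kappa> \<longlonglongrightarrow> 0"
    unfolding \<kappa>_def by (intro tendsto_null_sum) auto
  have lim: "(\<lambda>j. poly (N (\<sigma> j)) (of_real x)) \<longlonglongrightarrow> poly L (of_real x)" if "x \<in> {-1..1}" for x
    by (rule LIM_zero_cancel, rule Lim_null_comparison[OF _ \<kappa>])
       (use diff[OF that] in \<open>simp add: \<kappa>_def\<close>)
  have twist_lim: "(\<lambda>j. twist \<omega> (N (\<sigma> j)) x) \<longlonglongrightarrow> twist \<omega> L x" if "x \<in> {-1..1}" for x
    unfolding twist_def by (intro tendsto_intros lim that)
  \<comment> \<open>Only weak inequalities pass to the limit, and \<open>L\<close> might still
    vanish on \<open>[-1, 1]\<close>; hence the division-free form of the error bound.\<close>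
  have ReL: "0 \<le> Re (twist \<omega> L x)" if "x \<in> {-1..1}" for x
  proof (rule LIMSEQ_le_const[OF tendsto_Re[OF twist_lim[OF that]]])
    show "\<exists>M. \<forall>j\<ge>M. 0 \<le> Re (twist \<omega> (N (\<sigma> j)) x)"
      using P(2)[OF that] S by (auto simp: N(2) less_imp_le)
  qed
  have errL: "2 * \<bar>Im (twist \<omega> L x)\<bar> \<le> e * cmod (twist \<omega> L x)" if "x \<in> {-1..1}" for x
  proof (rule LIMSEQ_le)
    show "(\<lambda>j. 2 * \<bar>Im (twist \<omega> (N (\<sigma> j)) x)\<bar>) \<longlonglongrightarrow> 2 * \<bar>Im (twist \<omega> L x)\<bar>"
      by (intro tendsto_intros twist_lim that)
    show "(\<lambda>j. E (\<sigma> j) * cmod (twist \<omega> (N (\<sigma> j)) x)) \<longlonglongrightarrow> e * cmod (twist \<omega> L x)"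
      using LIMSEQ_subseq_LIMSEQ[OF E \<sigma>(1)] by (intro tendsto_intros twist_lim that) (simp add: o_def)
    have "2 * \<bar>Im (twist \<omega> (N (\<sigma> j)) x)\<bar> \<le> E (\<sigma> j) * cmod (twist \<omega> (N (\<sigma> j)) x)" for j
      using err[OF that, of "\<sigma> j"] S[of "\<sigma> j"] by (simp add: N(2) norm_mult norm_divide abs_mult divide_right_mono)
    then show "\<exists>M. \<forall>j\<ge>M. 2 * \<bar>Im (twist \<omega> (N (\<sigma> j)) x)\<bar> \<le> E (\<sigma> j) * cmod (twist \<omega> (N (\<sigma> j)) x)"
      by blast
  qed
  have "(\<lambda>j. \<Sum>i\<le>n. cmod (coeff (N (\<sigma> j)) i)) \<longlonglongrightarrow> (\<Sum>i\<le>n. cmod (a i))"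
    by (intro tendsto_intros a) auto
  then have "(\<Sum>i\<le>n. cmod (a i)) = 1"
    unfolding N(3) by (simp add: LIMSEQ_const_iff)
  then have "L \<noteq> 0"
    using coeffL by (metis (no_types, lifting) atMost_iff coeff_0 norm_zero sum.neutral zero_neq_one)
  have "Im (cnj (poly L (of_real x)) * poly Q (of_real x)) = 0" for x :: real
  proof (rule alternation_imp_Im_zero[OF \<open>degree L \<le> n\<close> eq_refl[OF Q(2)] mono s])
    fix k assume k: "k \<le> 2*n+1"
    note \<xi>k = \<xi>(1)[OF k]
    \<comment> \<open>At \<open>\<xi> k\<close> the error belonging to \<open>Q\<close> is exactly
      \<open>e\<close>, while \<open>L\<close> satisfies the bound by \<open>e\<close>; so
      \<open>Q\<close> dominates.\<close>
    have "2 * (\<bar>Im (twist \<omega> L (\<xi> k))\<bar> * cmod (twist \<omega> Q (\<xi> k))) \<le>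
        e * cmod (twist \<omega> L (\<xi> k)) * cmod (twist \<omega> Q (\<xi> k))"
      using mult_right_mono[OF errL[OF \<xi>k], of "cmod (twist \<omega> Q (\<xi> k))"] by simp
    also have "\<dots> = 2 * (\<bar>Im (twist \<omega> Q (\<xi> k))\<bar> * cmod (twist \<omega> L (\<xi> k)))"
      using \<xi>(3)[OF k] by (metis mult.assoc mult.commute)
    finally have "\<bar>Im (twist \<omega> L (\<xi> k))\<bar> * cmod (twist \<omega> Q (\<xi> k)) \<le> \<bar>Im (twist \<omega> Q (\<xi> k))\<bar> * cmod (twist \<omega> L (\<xi> k))"
      by simp
    moreover have "s * (-1) ^ k = 1 \<or> s * (-1) ^ k = -1"
      using s by (cases "even k") auto
    ultimately show "0 \<le> s * (-1) ^ k * Im (cnj (poly L (of_real (\<xi> k))) * poly Q (of_real (\<xi> k)))"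
      unfolding cnj_twist_mult[of \<omega>, symmetric]
      using Im_cnj_mult_sign(1)[OF less_imp_le[OF ReQ[OF \<xi>k]] ReL[OF \<xi>k]] \<xi>(2)[OF k] by blast
  qed
  then have eq: "cnj (poly L (of_real x)) * poly Q (of_real x) = poly L (of_real x) * cnj (poly Q (of_real x))" for x :: real
    by (simp add: complex_eq_iff algebra_simps)
  have "map_poly cnj L * Q = L * map_poly cnj Q"
    by (rule poly_eqI_of_real) (simp add: eq)
  \<comment> \<open>\<open>Q\<close> is coprime to its conjugate, so it divides \<open>L\<close>;
    since its degree \<open>n\<close> bounds that of \<open>L\<close>, the cofactor is
    constant.\<close>
  then have "Q dvd L * map_poly cnj Q"
    by (metis dvd_triv_right)
  then have "Q dvd L"
    using Q(1) coprime_dvd_mult_left_iff by blast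
  then obtain c where c: "L = Q * c" ..
  have "Q \<noteq> 0" "c \<noteq> 0" using \<open>L \<noteq> 0\<close> c by auto
  then have "degree c = 0"
    using \<open>degree L \<le> n\<close> Q(2) c by (simp add: degree_mult_eq)
  then obtain c0 where c0: "c = [:c0:]" by (rule degree_eq_zeroE)
  have L: "poly L z = c0 * poly Q z" for z
    unfolding c c0 by (simp add: mult.commute)
  have "c0 \<noteq> 0" using \<open>c \<noteq> 0\<close> c0 by simp
  then have neL: "poly L (of_real x) \<noteq> 0" if "x \<in> {-1..1}" for x
    using neQ[OF that] by (simp add: L)
  have ratioL: "cnj (poly L (of_real x)) / poly L (of_real x) = cnj (poly Q (of_real x)) / poly Q (of_real x)"
    if "x \<in> {-1..1}" for x
    using eq[of x] neL[OF that] neQ[OF that] by (simp add: field_simps)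
  have "continuous_on {-1..1} (\<lambda>x::real. cmod (poly L (of_real x)))"
    by (intro continuous_intros)
  from continuous_attains_inf[OF compact_Icc _ this]
  obtain x0 :: real where x0: "x0 \<in> {-1..1}"
    "\<And>x::real. x \<in> {-1..1} \<Longrightarrow> cmod (poly L (of_real x0)) \<le> cmod (poly L (of_real x))"
    by fastforce
  define d where "d = cmod (poly L (of_real x0))"
  have "0 < d"
    using neL[OF x0(1)] by (simp add: d_def)
  show thesis
  proof (rule that[OF \<sigma>(1)])
    show "(\<lambda>j. 2 * \<kappa> j / d) \<longlonglongrightarrow> 0"
      using \<kappa> \<open>0 < d\<close> by (auto intro!: tendsto_eq_intros)
  next
    fix j and x :: real assume x: "x \<in> {-1..1}"
    let ?p = "poly (N (\<sigma> j)) (of_real x)" and ?q = "poly L (of_real x)"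
    have "cnj (poly (P (\<sigma> j)) (of_real x)) / poly (P (\<sigma> j)) (of_real x) = cnj ?p / ?p" "?p \<noteq> 0"
      using S[of "\<sigma> j"] neP[OF x] by (simp_all add: N_def)
    then have "cmod (cnj (poly (P (\<sigma> j)) (of_real x)) / poly (P (\<sigma> j)) (of_real x) -
        cnj (poly Q (of_real x)) / poly Q (of_real x)) = cmod (cnj ?p / ?p - cnj ?q / ?q)"
      using ratioL[OF x] by simp
    also have "\<dots> \<le> 2 * cmod (?p - ?q) / cmod ?q"
      using conj_quotient_diff_bound[OF \<open>?p \<noteq> 0\<close> neL[OF x]] .
    also have "\<dots> \<le> 2 * \<kappa> j / d"
      using diff[OF x, of j] x0(2)[OF x] \<open>0 < d\<close> unfolding \<kappa>_def d_def
      by (intro frac_le mult_left_mono) (auto intro: sum_nonneg)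
    finally show "cmod (cnj (poly (P (\<sigma> j)) (of_real x)) / poly (P (\<sigma> j)) (of_real x) -
        cnj (poly Q (of_real x)) / poly Q (of_real x)) \<le> 2 * \<kappa> j / d" .
  qed
qed

text \<open>If convergence failed, some subsequence would stay \<open>\<epsilon>\<close> away from
  \<open>r\<close>; the preceding lemma extracts from it a further subsequence converging to
  \<open>r\<close>.\<close>

lemma minimizing_sequence_tendsto_best_approximant:
  assumes best: "unitary_best_approximant n \<omega> r" and "\<omega> \<noteq> 0" and less2: "approx_error \<omega> r < 2"
    and R: "\<And>j. R j \<in> unitary_functions n" "\<And>j. approx_error \<omega> (R j) < 2"
    and lim: "(\<lambda>j. approx_error \<omega> (R j)) \<longlonglongrightarrow> approx_error \<omega> r"
  shows "(\<lambda>j. imag_norm (\<lambda>z. R j z - r z)) \<longlonglongrightarrow> 0"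
proof (rule ccontr)
  assume "\<not> ?thesis"
  then obtain \<epsilon> where "0 < \<epsilon>" and far: "\<not> (\<forall>\<^sub>F j in sequentially. \<bar>imag_norm (\<lambda>z. R j z - r z)\<bar> < \<epsilon>)"
    unfolding tendsto_iff dist_real_def by auto
  obtain \<rho> :: "nat \<Rightarrow> nat" where \<rho>: "strict_mono \<rho>" "\<And>j. \<not> \<bar>imag_norm (\<lambda>z. R (\<rho> j) z - r z)\<bar> < \<epsilon>"
    using not_eventually_sequentiallyD[OF far] by blast
  have r: "r \<in> unitary_functions n"
    using best by (auto simp: unitary_best_approximant_def is_arg_min_def)
  obtain Q where Q: "degree Q \<le> n" "coprime Q (map_poly cnj Q)" "\<And>x::real. poly Q (of_real x) \<noteq> 0"
    "\<And>x::real. r (\<i> * of_real x) = cnj (poly Q (of_real x)) / poly Q (of_real x)"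
    "\<And>x. x \<in> {-1..1} \<Longrightarrow> 0 < Re (twist \<omega> Q x)"
    by (rule unitary_representation[OF r less2]) (rule that)
  have "\<exists>P. degree P \<le> n \<and> (\<forall>x::real. poly P (of_real x) \<noteq> 0) \<and>
      (\<forall>x::real. R (\<rho> j) (\<i> * of_real x) = cnj (poly P (of_real x)) / poly P (of_real x)) \<and>
      (\<forall>x\<in>{-1..1}. 0 < Re (twist \<omega> P x))" for j
  proof -
    obtain P where P: "degree P \<le> n" "coprime P (map_poly cnj P)" "\<And>x::real. poly P (of_real x) \<noteq> 0"
      "\<And>x::real. R (\<rho> j) (\<i> * of_real x) = cnj (poly P (of_real x)) / poly P (of_real x)"
      "\<And>x. x \<in> {-1..1} \<Longrightarrow> 0 < Re (twist \<omega> P x)"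
      by (rule unitary_representation[OF R]) (rule that)
    show ?thesis
      by (intro exI[of _ P] conjI allI ballI P)
  qed
  then obtain P where P: "\<And>j. degree (P j) \<le> n" "\<And>j (x::real). poly (P j) (of_real x) \<noteq> 0"
    "\<And>j (x::real). R (\<rho> j) (\<i> * of_real x) = cnj (poly (P j) (of_real x)) / poly (P j) (of_real x)"
    "\<And>j x. x \<in> {-1..1} \<Longrightarrow> 0 < Re (twist \<omega> (P j) x)"
    by metis
  have err: "2 * \<bar>Im (twist \<omega> (P j) x)\<bar> \<le> approx_error \<omega> (R (\<rho> j)) * cmod (twist \<omega> (P j) x)"
    if "x \<in> {-1..1}" for j x
    using pointwise_error_le[OF R(1) that, of \<omega> "\<rho> j"] P(2)[of j x]
      pointwise_error_twist[where r = "R (\<rho> j)" and P = "P j" and x = x and \<omega> = \<omega>, OF P(3,2)]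
    by (simp add: field_simps twist_eq_0_iff)
  obtain \<xi> s where alt: "degree Q = n" "strict_mono_on {..2*n+1} \<xi>" "s = 1 \<or> s = (-1::real)"
    "\<And>k. k \<le> 2*n+1 \<Longrightarrow> \<xi> k \<in> {-1..1}"
    "\<And>k. k \<le> 2*n+1 \<Longrightarrow> 0 \<le> s * (-1) ^ k * Im (twist \<omega> Q (\<xi> k))"
    "\<And>k. k \<le> 2*n+1 \<Longrightarrow> 2 * \<bar>Im (twist \<omega> Q (\<xi> k))\<bar> = approx_error \<omega> r * cmod (twist \<omega> Q (\<xi> k))"
    using best_approximant_alternates[OF best \<open>\<omega> \<noteq> 0\<close> less2 Q(1,2,4,5)] by blast
  have "(\<lambda>j. approx_error \<omega> (R (\<rho> j))) \<longlonglongrightarrow> approx_error \<omega> r"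
    using LIMSEQ_subseq_LIMSEQ[OF lim \<rho>(1)] by (simp add: o_def)
  from limit_of_minimizing_sequence[OF Q(2) alt(1) Q(5) alt(2-6) P(1,4) err this]
  obtain \<sigma> b where "strict_mono \<sigma>" "b \<longlonglongrightarrow> (0::real)" and
    b: "\<And>j x. x \<in> {-1..1} \<Longrightarrow> cmod (cnj (poly (P (\<sigma> j)) (of_real x)) / poly (P (\<sigma> j)) (of_real x) -
        cnj (poly Q (of_real x)) / poly Q (of_real x)) \<le> b j"
    by blast
  have "\<forall>\<^sub>F j in sequentially. b j < \<epsilon>"
    using \<open>b \<longlonglongrightarrow> 0\<close> \<open>0 < \<epsilon>\<close> by (rule order_tendstoD(2))
  then obtain j where j: "b j < \<epsilon>"
    by (auto simp: eventually_sequentially)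
  have le: "cmod (R (\<rho> (\<sigma> j)) (\<i> * of_real x) - r (\<i> * of_real x)) \<le> b j" if "x \<in> {-1..1}" for x
    unfolding P(3) Q(4) using b[OF that] .
  have "imag_norm (\<lambda>z. R (\<rho> (\<sigma> j)) z - r z) \<le> b j"
    unfolding imag_norm_def using le by (intro cSUP_least) auto
  moreover have "0 \<le> imag_norm (\<lambda>z. R (\<rho> (\<sigma> j)) z - r z)"
    unfolding imag_norm_def
  proof (rule order_trans[OF norm_ge_zero])
    show "cmod (R (\<rho> (\<sigma> j)) (\<i> * of_real 0) - r (\<i> * of_real 0)) \<le>
        (SUP x\<in>{-1..1::real}. cmod (R (\<rho> (\<sigma> j)) (\<i> * of_real x) - r (\<i> * of_real x)))"
      by (intro cSUP_upper bdd_aboveI2[where M = "b j"] le) auto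
  qed
  ultimately show False
    using \<rho>(2)[of "\<sigma> j"] j by simp
qed

section \<open>Interpolatory alternating functions\<close>

lemma conj_quotient_twist:
  assumes "poly P (of_real x) \<noteq> 0"
  shows "cnj (poly P (of_real x)) / poly P (of_real x) / cis (\<omega> * x) = cnj (twist \<omega> P x) / twist \<omega> P x"
proof -
  define c where "c = cis (\<omega> * x / 2)"
  define p where "p = poly P (of_real x)"
  have c: "cis (\<omega> * x) = c * c" "cnj c * c = 1" "c \<noteq> 0"
    by (simp_all add: c_def cis_mult cis_cnj)
  have "cnj p / p / (c * c) = (cnj c * c) * cnj p / (p * c * c)"
    unfolding c(2) by simp
  also have "\<dots> = cnj (p * c) / (p * c)"
    using c(3) assms by (simp add: p_def)
  finally show ?thesis
    unfolding twist_def c(1) c_def[symmetric] p_def[symmetric] .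
qed

text \<open>A bound of de la Vallee-Poussin type. If the error of \<open>r'\<close> were below
  \<open>m\<close>, the phase error of \<open>r\<close> would dominate at all points, and the phase
  difference would alternate strictly too often.\<close>

lemma alternating_error_lower_bound:
  assumes r: "r \<in> unitary_functions n" "approx_error \<omega> r < 2"
    and r': "r' \<in> unitary_functions n"
    and mono: "strict_mono_on {..2*n+1} \<eta>" and \<eta>: "\<And>k. k \<le> 2*n+1 \<Longrightarrow> \<eta> k \<in> {-1..1}"
    and s: "s = 1 \<or> s = (-1::real)"
    and alt: "\<And>k. k \<le> 2*n+1 \<Longrightarrow> 0 \<le> s * (-1) ^ k * Im (r (\<i> * of_real (\<eta> k)) / cis (\<omega> * \<eta> k))"
    and m: "\<And>k. k \<le> 2*n+1 \<Longrightarrow> m \<le> pointwise_error \<omega> r (\<eta> k)"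
  shows "m \<le> approx_error \<omega> r'"
proof (rule ccontr)
  assume "\<not> ?thesis"
  then have less: "approx_error \<omega> r' < m" by simp
  also have "m \<le> approx_error \<omega> r"
    using m[of 0] pointwise_error_le[OF r(1) \<eta>[of 0], of \<omega>] by simp
  also note r(2)
  finally have r'2: "approx_error \<omega> r' < 2" .
  obtain P where P: "degree P \<le> n" "coprime P (map_poly cnj P)" "\<And>x::real. poly P (of_real x) \<noteq> 0"
    "\<And>x::real. r (\<i> * of_real x) = cnj (poly P (of_real x)) / poly P (of_real x)"
    "\<And>x. x \<in> {-1..1} \<Longrightarrow> 0 < Re (twist \<omega> P x)"
    by (rule unitary_representation[OF r]) (rule that)
  obtain Q where Q: "degree Q \<le> n" "coprime Q (map_poly cnj Q)" "\<And>x::real. poly Q (of_real x) \<noteq> 0"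
    "\<And>x::real. r' (\<i> * of_real x) = cnj (poly Q (of_real x)) / poly Q (of_real x)"
    "\<And>x. x \<in> {-1..1} \<Longrightarrow> 0 < Re (twist \<omega> Q x)"
    by (rule unitary_representation[OF r' r'2]) (rule that)
  have pos: "0 < - s * (-1) ^ k * Im (cnj (poly Q (of_real (\<eta> k))) * poly P (of_real (\<eta> k)))"
    if k: "k \<le> 2*n+1" for k
  proof -
    let ?x = "\<eta> k" and ?A = "twist \<omega> P (\<eta> k)" and ?B = "twist \<omega> Q (\<eta> k)"
    have ne: "?A \<noteq> 0" "?B \<noteq> 0"
      using P(3) Q(3) by (auto simp: twist_eq_0_iff)
    have "pointwise_error \<omega> r' ?x < pointwise_error \<omega> r ?x"
      using pointwise_error_le[OF r' \<eta>[OF k], of \<omega>] m[OF k] less by simp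
    then have "2 * \<bar>Im ?B\<bar> / cmod ?B < 2 * \<bar>Im ?A\<bar> / cmod ?A"
      using pointwise_error_twist[where r = r and P = P and x = ?x and \<omega> = \<omega>, OF P(4,3)]
        pointwise_error_twist[where r = r' and P = Q and x = ?x and \<omega> = \<omega>, OF Q(4,3)] by simp
    then have *: "\<bar>Im ?B\<bar> * cmod ?A < \<bar>Im ?A\<bar> * cmod ?B"
      using ne by (simp add: field_simps)
    have "r (\<i> * of_real ?x) / cis (\<omega> * ?x) = cnj ?A / ?A"
      unfolding P(4) using conj_quotient_twist[OF P(3)] .
    also have "\<dots> = cnj ?A * cnj ?A / of_real ((cmod ?A)\<^sup>2)"
      using ne by (simp add: complex_norm_square del: of_real_power)
    \<comment> \<open>The phase error is \<open>-2 * arg ?A\<close>, whence the minus sign and the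
      passage from \<open>s\<close> to \<open>- s\<close>.\<close>
    finally have "Im (r (\<i> * of_real ?x) / cis (\<omega> * ?x)) = - (2 * Re ?A * Im ?A) / (cmod ?A)\<^sup>2"
      by (simp add: Im_divide_of_real del: of_real_power)
    then have "s * (-1) ^ k * Im (r (\<i> * of_real ?x) / cis (\<omega> * ?x)) =
        (2 * Re ?A / (cmod ?A)\<^sup>2) * (- s * (-1) ^ k * Im ?A)"
      by simp
    then have "0 \<le> (2 * Re ?A / (cmod ?A)\<^sup>2) * (- s * (-1) ^ k * Im ?A)"
      using alt[OF k] by simp
    moreover have "0 < 2 * Re ?A / (cmod ?A)\<^sup>2"
      using P(5)[OF \<eta>[OF k]] ne by simp
    ultimately have "0 \<le> - s * (-1) ^ k * Im ?A"
      by (simp only: zero_le_mult_iff) auto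
    moreover have "- s * (-1) ^ k = 1 \<or> - s * (-1) ^ k = -1"
      using s by (cases "even k") auto
    ultimately show ?thesis
      unfolding cnj_twist_mult[of \<omega>, symmetric]
      using Im_cnj_mult_sign(2)[OF less_imp_le[OF P(5)[OF \<eta>[OF k]]] less_imp_le[OF Q(5)[OF \<eta>[OF k]]]] * by blast
  qed
  have "- s = 1 \<or> - s = -1" using s by auto
  from alternation_imp_Im_zero[OF Q(1) P(1) mono this less_imp_le[OF pos], of "\<eta> 0"] pos[of 0]
  show False by simp
qed

lemma interpolatory_alternating_unitary:
  assumes "interpolatory_alternating n \<omega> r x \<eta>"
  shows "r \<in> unitary_functions n"
  using assms by (auto simp: interpolatory_alternating_def unitary_functions_def phase_function_def)

text \<open>Shifts the indices from \<open>{1..2*n+2}\<close> to \<open>{..2*n+1}\<close>, as the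
  alternation lemmas require.\<close>

lemma interlaced_points:
  assumes "interlaced n x \<eta>"
  shows "strict_mono_on {..2*n+1} (\<lambda>k. \<eta> (Suc k))"
    and "k \<le> 2*n+1 \<Longrightarrow> \<eta> (Suc k) \<in> {-1..1}"
proof -
  have step: "\<eta> k < \<eta> (Suc k)" if "1 \<le> k" "k \<le> 2*n+1" for k
    using assms that unfolding interlaced_def by (metis Suc_eq_plus1 atLeastAtMost_iff order_less_trans)
  have less: "j \<le> 2*n+2 \<Longrightarrow> 1 \<le> i \<Longrightarrow> i < j \<Longrightarrow> \<eta> i < \<eta> j" for i j
  proof (induction j)
    case (Suc j)
    then show ?case
      using step[of j] by (cases "i = j") auto
  qed simp
  show "strict_mono_on {..2*n+1} (\<lambda>k. \<eta> (Suc k))"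
    by (auto simp: strict_mono_on_def intro!: less)
  show "\<eta> (Suc k) \<in> {-1..1}" if "k \<le> 2*n+1"
  proof -
    have "-1 \<le> \<eta> 1" "\<eta> (2*n+2) \<le> 1"
      using assms by (auto simp: interlaced_def)
    moreover have "\<eta> 1 \<le> \<eta> (Suc k)"
      using less[of "Suc k" 1] that by (cases "k = 0") auto
    moreover have "\<eta> (Suc k) \<le> \<eta> (2*n+2)"
      using less[of "2*n+2" "Suc k"] that by (cases "k = 2*n+1") auto
    ultimately show ?thesis by auto
  qed
qed

text \<open>The phase error lies in \<open>(-pi, pi)\<close>, so it has weakly the sign of its sine,
  which is the imaginary part of \<open>r\<close> divided by the exponential.\<close>

lemma interpolatory_alternating_sign:
  assumes "interpolatory_alternating n \<omega> r x \<eta>"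
  obtains s where "s = 1 \<or> s = (-1::real)"
    "\<And>k. k \<le> 2*n+1 \<Longrightarrow> 0 \<le> s * (-1) ^ k * Im (r (\<i> * of_real (\<eta> (Suc k))) / cis (\<omega> * \<eta> (Suc k)))"
proof -
  from assms obtain g \<iota> where g: "phase_function \<omega> r g"
    and \<iota>: "\<And>j. j \<in> {1..2*n+2} \<Longrightarrow> g (\<eta> j) - \<omega> * \<eta> j = (-1) ^ (j + \<iota>) * \<bar>g (\<eta> j) - \<omega> * \<eta> j\<bar>"
    unfolding interpolatory_alternating_def by blast
  have inter: "interlaced n x \<eta>"
    using assms by (simp add: interpolatory_alternating_def)
  show thesis
  proof
    show "(-1) ^ Suc \<iota> = (1::real) \<or> (-1) ^ Suc \<iota> = (-1::real)"
      by (simp add: minus_one_power_iff)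
  next
    fix k assume k: "k \<le> 2*n+1"
    let ?y = "\<eta> (Suc k)"
    define d where "d = g ?y - \<omega> * ?y"
    define \<sigma> :: real where "\<sigma> = (-1) ^ (Suc k + \<iota>)"
    have \<sigma>: "\<sigma> = 1 \<or> \<sigma> = -1"
      unfolding \<sigma>_def by (cases "even (Suc k + \<iota>)") auto
    have d: "d = \<sigma> * \<bar>d\<bar>"
      using \<iota>[of "Suc k"] k by (simp add: d_def \<sigma>_def)
    have "\<bar>d\<bar> < pi"
      using g interlaced_points(2)[OF inter k] by (simp add: phase_function_def d_def)
    then have "0 \<le> sin \<bar>d\<bar>"
      by (intro sin_ge_zero) auto
    also have "sin \<bar>d\<bar> = \<sigma> * sin d"
      using \<sigma> d by (cases "0 \<le> d") auto
    also have "sin d = Im (r (\<i> * of_real ?y) / cis (\<omega> * ?y))"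
      using g by (simp add: phase_function_def cis_divide d_def)
    finally show "0 \<le> (-1) ^ Suc \<iota> * (-1) ^ k * Im (r (\<i> * of_real ?y) / cis (\<omega> * ?y))"
      by (simp add: \<sigma>_def power_add mult_ac)
  qed
qed

lemma interpolatory_alternating_error_le_Max:
  assumes alt: "interpolatory_alternating n \<omega> r x \<eta>"
  shows "approx_error \<omega> r \<le> Max ((\<lambda>k. pointwise_error \<omega> r (\<eta> k)) ` {1..2*n+2})"
proof (rule approx_error_le)
  fix t :: real assume t: "t \<in> {-1..1}"
  let ?e = "pointwise_error \<omega> r"
  have "is_arg_max ?e (\<lambda>t. t \<in> {-1..<x 1}) (\<eta> 1)"
    "\<forall>j\<in>{2..2*n+1}. is_arg_max ?e (\<lambda>t. t \<in> {x (j-1)<..<x j}) (\<eta> j)"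
    "is_arg_max ?e (\<lambda>t. t \<in> {x (2*n+1)<..1}) (\<eta> (2*n+2))"
    using alt unfolding interpolatory_alternating_def by blast+
  then have argmax: "\<And>t. t \<in> {-1..<x 1} \<Longrightarrow> ?e t \<le> ?e (\<eta> 1)"
    "\<And>j t. j \<in> {2..2*n+1} \<Longrightarrow> t \<in> {x (j-1)<..<x j} \<Longrightarrow> ?e t \<le> ?e (\<eta> j)"
    "\<And>t. t \<in> {x (2*n+1)<..1} \<Longrightarrow> ?e t \<le> ?e (\<eta> (2*n+2))"
    unfolding is_arg_max_linorder by blast+
  \<comment> \<open>The error vanishes at nodes, so any of the points would serve as a
    bound.\<close>
  have node: "?e (x j) \<le> ?e (\<eta> 1)" if "j \<in> {1..2*n+1}" for j
    using alt that unfolding interpolatory_alternating_def pointwise_error_def by simp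
  \<comment> \<open>Induction from left to right over the nodes; the base case is vacuous because
    node indices start at 1.\<close>
  have left: "m \<in> {1..2*n+1} \<Longrightarrow> t \<le> x m \<Longrightarrow> \<exists>j\<in>{1..2*n+2}. ?e t \<le> ?e (\<eta> j)" for m
  proof (induction m)
    case (Suc m)
    consider "t = x (Suc m)" | "m = 0" "t < x 1" | "0 < m" "t \<le> x m" | "0 < m" "x m < t" "t < x (Suc m)"
      using Suc.prems(2) by (cases "m = 0") fastforce+
    then show ?case
    proof cases
      case 1
      then show ?thesis using node[OF Suc.prems(1)] by (intro bexI[of _ 1]) auto
    next
      case 2
      then show ?thesis using argmax(1)[of t] t by (intro bexI[of _ 1]) auto
    next
      case 3
      then show ?thesis using Suc by auto
    next
      case 4
      then show ?thesis using argmax(2)[of "Suc m" t] Suc.prems(1) by (intro bexI[of _ "Suc m"]) auto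
    qed
  qed simp
  have "\<exists>j\<in>{1..2*n+2}. ?e t \<le> ?e (\<eta> j)"
  proof (cases "t \<le> x (2*n+1)")
    case True
    then show ?thesis using left[of "2*n+1"] by simp
  next
    case False
    then show ?thesis using argmax(3)[of t] t by (intro bexI[of _ "2*n+2"]) auto
  qed
  then obtain j where "j \<in> {1..2*n+2}" "?e t \<le> ?e (\<eta> j)" ..
  then show "?e t \<le> Max ((\<lambda>k. ?e (\<eta> k)) ` {1..2*n+2})"
    by (meson Max_ge finite_atLeastAtMost finite_imageI image_eqI order_trans)
qed

text \<open>\<open>1 - \<delta>\<close> is the quotient of the least and greatest
  \<open>\<epsilon>\<^sub>j\<close>. The error of \<open>r\<close> is at most the greatest, and no
  unitary function has an error below the least.\<close>

lemma interpolatory_alternating_bounds: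
  assumes alt: "interpolatory_alternating n \<omega> r x \<eta>" and best: "unitary_best_approximant n \<omega> rt"
  shows "(1 - error_in_uniformity n \<omega> r \<eta>) * approx_error \<omega> r \<le> approx_error \<omega> rt"
    and "approx_error \<omega> rt \<le> approx_error \<omega> r"
    and "0 \<le> error_in_uniformity n \<omega> r \<eta>"
proof -
  note r = interpolatory_alternating_unitary[OF alt]
  have rt: "rt \<in> unitary_functions n" and le: "approx_error \<omega> rt \<le> approx_error \<omega> r"
    using best r by (auto simp: unitary_best_approximant_def is_arg_min_def not_less)
  show "approx_error \<omega> rt \<le> approx_error \<omega> r" by fact
  have less2: "approx_error \<omega> r < 2" and inter: "interlaced n x \<eta>"
    using alt by (auto simp: interpolatory_alternating_def)
  define V where "V = (\<lambda>j. pointwise_error \<omega> r (\<eta> j)) ` {1..2*n+2}"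
  have V: "finite V" "V \<noteq> {}" by (auto simp: V_def)
  obtain s where s: "s = 1 \<or> s = (-1::real)"
    "\<And>k. k \<le> 2*n+1 \<Longrightarrow> 0 \<le> s * (-1) ^ k * Im (r (\<i> * of_real (\<eta> (Suc k))) / cis (\<omega> * \<eta> (Suc k)))"
    using interpolatory_alternating_sign[OF alt] by blast
  have lower: "Min V \<le> approx_error \<omega> rt"
  proof (rule alternating_error_lower_bound[OF r less2 rt interlaced_points(1)[OF inter] _ s])
    fix k assume k: "k \<le> 2*n+1"
    then show "Min V \<le> pointwise_error \<omega> r (\<eta> (Suc k))"
      using V by (intro Min_le) (auto simp: V_def)
    show "\<eta> (Suc k) \<in> {-1..1}"
      by (rule interlaced_points(2)[OF inter k])
  qed
  have upper: "approx_error \<omega> r \<le> Max V"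
    unfolding V_def by (rule interpolatory_alternating_error_le_Max[OF alt])
  have "0 \<le> Min V"
    using V by (auto simp: V_def pointwise_error_def)
  have "Min V \<le> Max V"
    using V by simp
  have \<delta>: "error_in_uniformity n \<omega> r \<eta> = 1 - Min V / Max V"
    by (simp add: error_in_uniformity_def V_def)
  \<comment> \<open>If \<open>Max V = 0\<close>, the quotient is 0 by the convention for
    division.\<close>
  have "Min V / Max V \<le> 1"
    using \<open>0 \<le> Min V\<close> \<open>Min V \<le> Max V\<close> by (cases "Max V = 0") (auto simp: divide_le_eq_1)
  then show "0 \<le> error_in_uniformity n \<omega> r \<eta>"
    unfolding \<delta> by simp
  have "Min V / Max V * approx_error \<omega> r \<le> Min V / Max V * Max V"
    using \<open>0 \<le> Min V\<close> \<open>Min V \<le> Max V\<close> upper by (intro mult_left_mono) auto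
  also have "\<dots> \<le> Min V"
    using \<open>0 \<le> Min V\<close> by (cases "Max V = 0") auto
  also note lower
  finally show "(1 - error_in_uniformity n \<omega> r \<eta>) * approx_error \<omega> r \<le> approx_error \<omega> rt"
    unfolding \<delta> by simp
qed

theorem corollary2p6:
  fixes n :: nat and \<omega> :: real and rt :: "complex \<Rightarrow> complex"
  assumes "0 < \<omega>" and "\<omega> < real (n + 1) * pi"
    and "unitary_best_approximant n \<omega> rt"
  shows "(\<forall>r x \<eta>. interpolatory_alternating n \<omega> r x \<eta> \<longrightarrow>
            (1 - error_in_uniformity n \<omega> r \<eta>) * approx_error \<omega> r \<le> approx_error \<omega> rt \<and>
            approx_error \<omega> rt \<le> approx_error \<omega> r \<and>
            \<bar>approx_error \<omega> r - approx_error \<omega> rt\<bar> / approx_error \<omega> r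
              \<le> error_in_uniformity n \<omega> r \<eta>) \<and>
         (\<forall>(R :: nat \<Rightarrow> complex \<Rightarrow> complex) (X :: nat \<Rightarrow> nat \<Rightarrow> real) (H :: nat \<Rightarrow> nat \<Rightarrow> real).
            (\<forall>j. interpolatory_alternating n \<omega> (R j) (X j) (H j)) \<longrightarrow>
            (\<lambda>j. error_in_uniformity n \<omega> (R j) (H j)) \<longlonglongrightarrow> 0 \<longrightarrow>
            (\<lambda>j. imag_norm (\<lambda>z. R j z - rt z)) \<longlonglongrightarrow> 0)"
proof (intro conjI allI impI)
  fix r x \<eta> assume alt: "interpolatory_alternating n \<omega> r x \<eta>"
  note bounds = interpolatory_alternating_bounds[OF alt assms(3)]
  show "(1 - error_in_uniformity n \<omega> r \<eta>) * approx_error \<omega> r \<le> approx_error \<omega> rt"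
    "approx_error \<omega> rt \<le> approx_error \<omega> r"
    by (fact bounds)+
  show "\<bar>approx_error \<omega> r - approx_error \<omega> rt\<bar> / approx_error \<omega> r \<le> error_in_uniformity n \<omega> r \<eta>"
    using bounds approx_error_nonneg[OF interpolatory_alternating_unitary[OF alt], of \<omega>]
    \<comment> \<open>For zero error the left-hand side is 0 by convention, and nonnegativity of the
      error in uniformity suffices.\<close>
    by (cases "approx_error \<omega> r = 0") (auto simp: divide_le_eq algebra_simps)
next
  fix R :: "nat \<Rightarrow> complex \<Rightarrow> complex" and X H :: "nat \<Rightarrow> nat \<Rightarrow> real"
  assume alt: "\<forall>j. interpolatory_alternating n \<omega> (R j) (X j) (H j)"
    and lim: "(\<lambda>j. error_in_uniformity n \<omega> (R j) (H j)) \<longlonglongrightarrow> 0"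
  note bounds = interpolatory_alternating_bounds[OF spec[OF alt] assms(3)]
  have R: "R j \<in> unitary_functions n" "approx_error \<omega> (R j) < 2" for j
    using interpolatory_alternating_unitary[OF spec[OF alt]] alt by (auto simp: interpolatory_alternating_def)
  \<comment> \<open>The difference of errors lies between 0 and \<open>\<delta>\<^sub>j\<close>
    times the error of \<open>R j\<close>, which is below 2.\<close>
  have dist: "norm (approx_error \<omega> (R j) - approx_error \<omega> rt) \<le> 2 * error_in_uniformity n \<omega> (R j) (H j)" for j
    using bounds[of j] mult_left_mono[OF less_imp_le[OF R(2)[of j]] bounds(3)[of j]]
    by (simp add: algebra_simps)
  have "(\<lambda>j. approx_error \<omega> (R j) - approx_error \<omega> rt) \<longlonglongrightarrow> 0"
  proof (rule Lim_null_comparison)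
    show "\<forall>\<^sub>F j in sequentially. norm (approx_error \<omega> (R j) - approx_error \<omega> rt) \<le>
        2 * error_in_uniformity n \<omega> (R j) (H j)"
      using dist by (rule always_eventually[OF allI])
    show "(\<lambda>j. 2 * error_in_uniformity n \<omega> (R j) (H j)) \<longlonglongrightarrow> 0"
      by (rule tendsto_mult_right_zero[OF lim])
  qed
  then have "(\<lambda>j. approx_error \<omega> (R j)) \<longlonglongrightarrow> approx_error \<omega> rt"
    by (rule LIM_zero_cancel)
  then show "(\<lambda>j. imag_norm (\<lambda>z. R j z - rt z)) \<longlonglongrightarrow> 0"
    \<comment> \<open>Comparison with \<open>R 0\<close> shows that the error of \<open>rt\<close>
      is below 2.\<close>
    using assms(1) bounds(2)[of 0] R(2)[of 0]
    by (intro minimizing_sequence_tendsto_best_approximant[OF assms(3) _ _ R]) auto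
qed

end
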